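(* Let $n\ge 2$, $v=(4^n-2^n)/2$, and let $s$ satisfy $2\le v-s\le 2^{n-1}$. Let $\bar S=\{g_{s+1},\ldots,g_v\}\subset\Omega$ be the even set whose matrix $\bar G=[g_{s+1}\cdots g_v]$ has the form $$\bar G=\begin{bmatrix}1 & 1'_{v-s-1}\\ 0_{n-1} & 2B\end{bmatrix},$$ where $B$ is an $(n-1)\times(v-s-1)$ binary matrix with distinct nonnull columns, and let $d$ be the two-level regular design associated with $B$. Then $\bar S$ yields an MA QC design in $2s$ factors and $2^{2n}$ runs if and only if the matrix $B$ is so chosen that (among all $(n-1)\times(v-s-1)$ binary matrices with distinct nonnull columns) the associated design $d$ sequentially minimizes $A_{2r-1}(d)+A_{2r}(d)$, for $r=2,3,\ldots$.
   Context: Two-level designs and wordlength pattern. A two-level design in $N$ runs and $q$ factors is an $N\times q$ matrix $D$ with entries $\pm1$ (rows = runs, possibly repeated; columns = factors). For a set $H$ of $k$ columns of $D$, $\rho_k(H;D)$ is the absolute value of the arithmetic mean of the $N$ entries of the entrywise (Schur) product of the columns in $H$. The wordlength pattern is $(A_1(D),\ldots,A_q(D))$, where $A_k(D)=\sum_H\rho_k(H;D)^2$, the sum being over all sets $H$ of $k$ columns; $A_k(D)=0$ for $k>q$. "Sequentially minimizes" a sequence of quantities means lexicographic minimization: minimize the first, then the second among minimizers of the first, and so on. Quaternary code (QC) designs. $Z_4$ denotes the integers mod 4; an element is even if it is 0 or 2 and odd otherwise. $\Delta=Z_4^n$ (column vectors). $\Omega\subset\Delta$ is the set of the $v=(4^n-2^n)/2$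 vectors having at least one odd element and whose first odd element is 1. For $S=\{g_1,\ldots,g_s\}\subset\Omega$ with $s$ elements, the QC design $D$ arising from $S$ is the $2^{2n}\times 2s$ matrix whose rows are indexed by $u\in\Delta$, the row of $u$ being obtained from $(u'g_1,\ldots,u'g_s)$ (reduced mod 4) by replacing each entry by a pair via the Gray map $0\to(1,1)$, $1\to(1,-1)$, $2\to(-1,-1)$, $3\to(-1,1)$. Such $D$ always has $A_1(D)=A_2(D)=0$. $D$ is an MA (minimum aberration) QC design in $2s$ factors and $2^{2n}$ runs if it sequentially minimizes $A_3(D),\ldots,A_{2s}(D)$ among the QC designs arising from all $s$-element subsets $S$ of $\Omega$. A subset $\bar S\subset\Omega$ with $v-s$ elements is said to yield the QC design $D$ arising from its complement $S=\Omega\setminus\bar S$. A set $\bar S=\{g_{s+1},\ldots,g_v\}$ is even if $g_j+g_k$ has all elements even for every $s+1\le j,k\le v$. (Because elementary row operations leave the row space of $\bar G$ invariant, the paper takes, without loss of generality, $\bar G$ for an even set in the form displayed in the claim.) Here $0_{n-1}$ is the column vector of $n-1$ zeros, $1'_{v-s-1}$ the row vector of $v-s-1$ ones, and the entries of $B$ are $0,1$. The regular design $d$ associated with (generated by) $B=[b_{s+2}\cdots b_v]$ is the $2^{n-1}\times(v-s-1)$ matrix with rows indexed by $x\in\{0,1\}^{n-1}$, the row of $x$ being $\left((-1)^{x'b_{s+2}},\ldots,(-1)^{x'b_v}\right)$; rows may be repeated. *)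

theory Defs
  imports "HOL-Library.Numeral_Type" "Jordan_Normal_Form.Matrix"
begin

section \<open>Two-level designs and sequential minimization\<close>

text \<open>
  Rows and columns are indexed by arbitrary finite sets, so that repeated rows and repeated
  columns are kept apart; entries are \<open>1\<close> or \<open>-1\<close> for all designs below.
\<close>

record ('r, 'c) design =
  runs :: "'r set"
  factors :: "'c set"
  entry :: "'r \<Rightarrow> 'c \<Rightarrow> real"

definition rho :: "('r, 'c) design \<Rightarrow> 'c set \<Rightarrow> real" where
  "rho D H = \<bar>(\<Sum>u\<in>runs D. \<Prod>c\<in>H. entry D u c) / real (card (runs D))\<bar>"

definition wordlength :: "('r, 'c) design \<Rightarrow> nat \<Rightarrow> real" where
  "wordlength D k = (\<Sum>H | H \<subseteq> factors D \<and> card H = k. (rho D H)\<^sup>2)"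

text \<open>
  Lexicographic minimization of the quantities \<open>f x k\<close>, with \<open>k\<close> running through \<open>K\<close> in increasing
  order, over \<open>x \<in> X\<close>.
\<close>

definition sequentially_minimizes :: "'a set \<Rightarrow> ('a \<Rightarrow> nat \<Rightarrow> real) \<Rightarrow> nat set \<Rightarrow> 'a \<Rightarrow> bool" where
  "sequentially_minimizes X f K x \<longleftrightarrow>
     x \<in> X \<and>
     (\<forall>k\<in>K. \<forall>y\<in>X. (\<forall>j\<in>K. j < k \<longrightarrow> f y j = f x j) \<longrightarrow> f x k \<le> f y k)"

section \<open>Quaternary code designs\<close>

text \<open>The numeral type \<open>4\<close> is the ring of integers modulo 4.\<close>

definition even_Z4 :: "4 \<Rightarrow> bool" where
  "even_Z4 x \<longleftrightarrow> x = 0 \<or> x = 2"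

definition Omega :: "nat \<Rightarrow> 4 vec set" where
  "Omega n = {g \<in> carrier_vec n. \<exists>i<n. g $ i = 1 \<and> (\<forall>j<i. even_Z4 (g $ j))}"

definition gray :: "4 \<Rightarrow> real \<times> real" where
  "gray x = (if x = 0 then (1, 1) else if x = 1 then (1, -1)
             else if x = 2 then (-1, -1) else (-1, 1))"

text \<open>
  The two columns coming from \<open>g \<in> S\<close> are indexed by \<open>(g, False)\<close> and \<open>(g, True)\<close>. The scalar
  product is taken in the type \<open>4\<close>, hence modulo 4.
\<close>

definition QC_design :: "nat \<Rightarrow> 4 vec set \<Rightarrow> (4 vec, 4 vec \<times> bool) design" where
  "QC_design n S =
     \<lparr>runs = carrier_vec n, factors = S \<times> UNIV,
      entry = (\<lambda>u (g, second). if second then snd (gray (u \<bullet> g)) else fst (gray (u \<bullet> g)))\<rparr>"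

definition QC_designs :: "nat \<Rightarrow> nat \<Rightarrow> (4 vec, 4 vec \<times> bool) design set" where
  "QC_designs n s = QC_design n ` {S. S \<subseteq> Omega n \<and> card S = s}"

definition MA_QC_design :: "nat \<Rightarrow> nat \<Rightarrow> (4 vec, 4 vec \<times> bool) design \<Rightarrow> bool" where
  "MA_QC_design n s D \<longleftrightarrow> sequentially_minimizes (QC_designs n s) wordlength {3..2 * s} D"

definition yielded_design :: "nat \<Rightarrow> 4 vec set \<Rightarrow> (4 vec, 4 vec \<times> bool) design" where
  "yielded_design n Sbar = QC_design n (Omega n - Sbar)"

definition even_set :: "nat \<Rightarrow> 4 vec set \<Rightarrow> bool" where
  "even_set n Sbar \<longleftrightarrow>
     Sbar \<subseteq> Omega n \<and> (\<forall>g\<in>Sbar. \<forall>h\<in>Sbar. \<forall>i<n. even_Z4 ((g + h) $ i))"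

section \<open>Binary matrices and regular designs\<close>

definition binary_matrices :: "nat \<Rightarrow> nat \<Rightarrow> nat mat set" where
  "binary_matrices m k =
     {B \<in> carrier_mat m k. elements_mat B \<subseteq> {0, 1} \<and> distinct (cols B) \<and> 0\<^sub>v m \<notin> set (cols B)}"

definition regular_design :: "nat mat \<Rightarrow> (nat vec, nat) design" where
  "regular_design B =
     \<lparr>runs = {x \<in> carrier_vec (dim_row B). set\<^sub>v x \<subseteq> {0, 1}}, factors = {..<dim_col B},
      entry = (\<lambda>x j. (-1) ^ (x \<bullet> col B j))\<rparr>"

definition Gbar :: "nat mat \<Rightarrow> 4 mat" where
  "Gbar B = four_block_mat
     (1\<^sub>m 1) (mat 1 (dim_col B) (\<lambda>_. 1))
     (0\<^sub>m (dim_row B) 1) (map_mat (\<lambda>b. 2 * of_nat b) B)"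

lemma Gbar_dim: "B \<in> carrier_mat m k \<Longrightarrow> Gbar B \<in> carrier_mat (Suc m) (Suc k)"
  unfolding Gbar_def by (auto simp: four_block_mat_def Let_def)

lemma Gbar_entry:
  assumes "B \<in> carrier_mat m k" "i < Suc m" "j < Suc k"
  shows "Gbar B $$ (i, j) = (if i = 0 then 1 else if j = 0 then 0 else 2 * of_nat (B $$ (i - 1, j - 1)))"
  using assms unfolding Gbar_def by (auto simp: four_block_mat_def Let_def)

lemma even_dbl: "even_Z4 (2 * of_nat b)"
proof (induction b rule: less_induct)
  case (less b)
  show ?case
  proof (cases "b < 2")
    case True then have "b = 0 \<or> b = 1" by auto
    then show ?thesis by (auto simp: even_Z4_def)
  next
    case False
    then obtain c where c: "b = c + 2" by (metis add.commute le_Suc_ex not_less)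
    have "(2 * of_nat b :: 4) = 4 + 2 * of_nat c" unfolding c by (simp add: distrib_left)
    also have "(4 :: 4) = 0" by simp
    finally have "(2 * of_nat b :: 4) = 2 * of_nat c" by (simp only: add_0)
    moreover have "even_Z4 (2 * of_nat c)" using less[of c] c by linarith
    ultimately show ?thesis by metis
  qed
qed

lemma even_add: "even_Z4 x \<Longrightarrow> even_Z4 y \<Longrightarrow> even_Z4 (x + y)"
  by (auto simp: even_Z4_def)

text \<open>
  The columns of \<open>Gbar B\<close> automatically form an even subset of \<open>Omega\<close> of the right size.
\<close>

lemma even_set_Gbar:
  assumes "B \<in> carrier_mat m k"
  shows "even_set (Suc m) (set (cols (Gbar B)))"
proof -
  have d: "dim_row (Gbar B) = Suc m" "dim_col (Gbar B) = Suc k" using Gbar_dim[OF assms] by auto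
  have c: "col (Gbar B) j $ i = (if i = 0 then 1 else if j = 0 then 0 else 2 * of_nat (B $$ (i - 1, j - 1)))"
    if "i < Suc m" "j < Suc k" for i j using that d Gbar_entry[OF assms that] by simp
  have s: "set (cols (Gbar B)) = col (Gbar B) ` {..<Suc k}" using d by (simp add: cols_def atLeast0LessThan del: upt_Suc)
  have o: "col (Gbar B) j \<in> Omega (Suc m)" if "j < Suc k" for j
    unfolding Omega_def using that c[of 0 j] d by (auto intro!: exI[of _ 0] carrier_vecI)
  have e: "even_Z4 ((col (Gbar B) j + col (Gbar B) l) $ i)" if "j < Suc k" "l < Suc k" "i < Suc m" for i j l
    using that d c[of i j] c[of i l] even_dbl even_add by (auto simp: even_Z4_def)
  show ?thesis unfolding even_set_def s using o e by auto
qed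

lemma card_Gbar:
  assumes B: "B \<in> binary_matrices m k"
  shows "card (set (cols (Gbar B))) = Suc k"
proof -
  have Bc: "B \<in> carrier_mat m k" and el: "elements_mat B \<subseteq> {0, 1}"
    and di: "distinct (cols B)" and nn: "0\<^sub>v m \<notin> set (cols B)"
    using B by (auto simp: binary_matrices_def)
  have bin: "B $$ (i, j) = 0 \<or> B $$ (i, j) = 1" if "i < m" "j < k" for i j
    using el elements_matI[OF Bc that refl] by auto
  have d: "dim_row (Gbar B) = Suc m" "dim_col (Gbar B) = Suc k" using Gbar_dim[OF Bc] by auto
  have c: "col (Gbar B) j $ i = (if i = 0 then 1 else if j = 0 then 0 else 2 * of_nat (B $$ (i - 1, j - 1)))"
    if "i < Suc m" "j < Suc k" for i j using that d Gbar_entry[OF Bc that] by simp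
  define e where "e j i = (if j = 0 then 0 else B $$ (i, j - 1))" for i j
  have e01: "e j i = 0 \<or> e j i = 1" if "i < m" "j < Suc k" for i j
    using bin[of i "j - 1"] that by (auto simp: e_def)
  have ce: "col (Gbar B) j $ Suc i = 2 * of_nat (e j i)" if "i < m" "j < Suc k" for i j
    using c[of "Suc i" j] that by (auto simp: e_def)
  have aux: "j = l" if jl: "j \<le> l" "l < Suc k" and eq: "col (Gbar B) j = col (Gbar B) l" for j l
  proof (rule ccontr)
    assume "j \<noteq> l"
    have E: "e j i = e l i" if i: "i < m" for i
      using ce[OF i, of j] ce[OF i, of l] e01[OF i, of j] e01[OF i, of l] jl eq by auto
    have l0: "l \<noteq> 0" using \<open>j \<noteq> l\<close> jl by auto
    show False
    proof (cases "j = 0")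
      case True
      have "col B (l - 1) = 0\<^sub>v m"
        using E True l0 jl Bc by (intro eq_vecI) (auto simp: e_def)
      moreover have "col B (l - 1) \<in> set (cols B)"
        using l0 jl Bc by (auto simp: cols_def)
      ultimately show False using nn by simp
    next
      case False
      have "col B (j - 1) = col B (l - 1)"
        using E False l0 jl Bc by (intro eq_vecI) (auto simp: e_def)
      then have "cols B ! (j - 1) = cols B ! (l - 1)"
        using False l0 jl Bc by (simp add: cols_nth)
      then have "j - 1 = l - 1"
        using nth_eq_iff_index_eq[OF di, of "j - 1" "l - 1"] False l0 jl Bc by simp
      then show False using False l0 \<open>j \<noteq> l\<close> by simp
    qed
  qed
  have "inj_on (col (Gbar B)) {..<Suc k}"
  proof (rule inj_onI)
    fix j l assume "j \<in> {..<Suc k}" "l \<in> {..<Suc k}" "col (Gbar B) j = col (Gbar B) l"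
    then show "j = l" using aux[of j l] aux[of l j] by (cases "j \<le> l") auto
  qed
  moreover have "set (cols (Gbar B)) = col (Gbar B) ` {..<Suc k}"
    using d by (simp add: cols_def atLeast0LessThan del: upt_Suc)
  ultimately show ?thesis by (simp add: card_image del: lessThan_Suc)
qed

end

theory Submission
  imports Defs "HOL-Computational_Algebra.Polynomial" "HOL-Library.FuncSet"
begin

text \<open>
  Since \<open>A\<^sub>k\<close> is an average of Krawtchouk polynomials of degree \<open>k\<close> in the sum \<open>c\<close> of the entries of a
  run, sequentially minimizing the wordlength pattern amounts to sequentially minimizing the power
  moments of \<open>c\<close>. For \<open>\<Omega>\<close> itself the sum \<open>c\<close> is known explicitly, so the moments for a set \<open>S\<close> are
  expressed by those for its complement. The third moment is smallest exactly when the complement is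
  even: zero-sum triples are outweighed by pairs that are congruent modulo 2. For an even complement
  with an element \<open>g\<^sub>0\<close>, the sum at the run \<open>u\<close> factors as the real part of \<open>i\<close> to the power \<open>u'g\<^sub>0\<close>
  times a sum of signs; odd moments vanish, and even moments are, up to a constant factor, the moments of \<open>1 + r\<close>
  where \<open>r\<close> is the row sum of the regular design \<open>d\<close>. By the parity of Krawtchouk polynomials, these
  even moments determine the patterns \<open>A\<^sub>2\<^sub>r\<close> of \<open>d\<close> with a column of ones adjoined, and these equal
  \<open>A\<^sub>2\<^sub>r\<^sub>-\<^sub>1(d) + A\<^sub>2\<^sub>r(d)\<close>.
\<close>

section \<open>Sequential minimization\<close>

lemma sequentially_minimizes_image:
  assumes "x \<in> X"
  shows "sequentially_minimizes (h ` X) f K (h x) \<longleftrightarrow> sequentially_minimizes X (\<lambda>y. f (h y)) K x"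
  using assms by (auto simp: sequentially_minimizes_def)

text \<open>The hypothesis is symmetric in \<open>x\<close> and \<open>y\<close>, so it transfers
  equality at \<open>k\<close> as well as order; strong induction on the index then shows that
  agreement up to \<open>k\<close> means the same for \<open>f\<close> and \<open>g\<close>. This
  fits a triangular change of quantities, where each \<open>g x k\<close> is a positive multiple of
  \<open>f x k\<close> plus terms in the earlier \<open>f x j\<close>.\<close>

lemma sequentially_minimizes_cong_order:
  assumes "\<And>k x y. \<lbrakk>k \<in> K; x \<in> X; y \<in> X; \<And>j. \<lbrakk>j \<in> K; j < k\<rbrakk> \<Longrightarrow> f x j = f y j\<rbrakk>
    \<Longrightarrow> f x k \<le> f y k \<longleftrightarrow> g x k \<le> g y k"
  shows "sequentially_minimizes X f K x \<longleftrightarrow> sequentially_minimizes X g K x"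
proof (cases "x \<in> X")
  case True
  have eq: "(\<forall>j\<in>K. j < k \<longrightarrow> f y j = f x j) \<longleftrightarrow> (\<forall>j\<in>K. j < k \<longrightarrow> g y j = g x j)"
    if y: "y \<in> X" for y k
  proof (induction k rule: less_induct)
    case (less k)
    have step: "f y j = f x j \<longleftrightarrow> g y j = g x j"
      if j: "j \<in> K" "\<forall>i\<in>K. i < j \<longrightarrow> f y i = f x i" for j
      using assms[OF j(1) y True] assms[OF j(1) True y] j(2) by (metis order.antisym order.refl)
    show ?case
    proof (intro iffI ballI impI)
      fix j assume *: "\<forall>j\<in>K. j < k \<longrightarrow> f y j = f x j" "j \<in> K" "j < k"
      then show "g y j = g x j" using step[of j] by auto
    next
      fix j assume *: "\<forall>j\<in>K. j < k \<longrightarrow> g y j = g x j" "j \<in> K" "j < k"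
      then have "\<forall>i\<in>K. i < j \<longrightarrow> f y i = f x i" using less[of j] by auto
      then show "f y j = f x j" using step[of j] * by auto
    qed
  qed
  have "((\<forall>j\<in>K. j < k \<longrightarrow> f y j = f x j) \<longrightarrow> f x k \<le> f y k) \<longleftrightarrow>
        ((\<forall>j\<in>K. j < k \<longrightarrow> g y j = g x j) \<longrightarrow> g x k \<le> g y k)"
    if "k \<in> K" "y \<in> X" for k y
    using assms[OF that(1) True that(2)] eq[OF that(2), of k] by metis
  then show ?thesis
    unfolding sequentially_minimizes_def by blast
qed (simp add: sequentially_minimizes_def)

lemma sequentially_minimizes_index_mono:
  assumes "K \<subseteq> L" and "\<And>k x y. \<lbrakk>k \<in> L - K; x \<in> X; y \<in> X\<rbrakk> \<Longrightarrow> f x k = f y k"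
  shows "sequentially_minimizes X f L x \<longleftrightarrow> sequentially_minimizes X f K x"
proof (cases "x \<in> X")
  case True
  have "((\<forall>j\<in>L. j < k \<longrightarrow> f y j = f x j) \<longleftrightarrow> (\<forall>j\<in>K. j < k \<longrightarrow> f y j = f x j))" if "y \<in> X" for y k
  proof -
    have "f y j = f x j" if "j \<in> L - K" for j
      using assms(2)[OF that \<open>y \<in> X\<close> True] .
    then show ?thesis using assms(1) by blast
  qed
  moreover have "f x k \<le> f y k" if "k \<in> L - K" "y \<in> X" for y k
    using assms(2)[OF that(1) True that(2)] by simp
  ultimately show ?thesis
    unfolding sequentially_minimizes_def using assms(1) by blast
qed (simp add: sequentially_minimizes_def)

text \<open>The last two assumptions make \<open>Z\<close> the set of minimizers at the first index
  \<open>k0\<close>, so that what remains is lexicographic minimization inside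
  \<open>Z\<close>.\<close>

lemma sequentially_minimizes_first:
  assumes "Z \<subseteq> X" "x \<in> Z" "\<And>k. k \<in> K \<Longrightarrow> k0 < k"
    and "\<And>y z. \<lbrakk>y \<in> X; z \<in> Z\<rbrakk> \<Longrightarrow> f z k0 \<le> f y k0"
    and "\<And>y z. \<lbrakk>y \<in> X; z \<in> Z; f y k0 = f z k0\<rbrakk> \<Longrightarrow> y \<in> Z"
  shows "sequentially_minimizes X f (insert k0 K) x \<longleftrightarrow> sequentially_minimizes Z f K x"
proof
  assume L: "sequentially_minimizes X f (insert k0 K) x"
  have "f y k0 = f x k0" if "y \<in> Z" for y
    using assms that by (meson order.antisym subsetD)
  moreover have "j \<in> K \<longrightarrow> k0 < j" for j using assms(3) by blast
  ultimately have "\<forall>j\<in>insert k0 K. j < k \<longrightarrow> f y j = f x j"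
    if "y \<in> Z" "\<forall>j\<in>K. j < k \<longrightarrow> f y j = f x j" for y k
    using that by simp
  then show "sequentially_minimizes Z f K x"
    using L assms(1,2) unfolding sequentially_minimizes_def by blast
next
  assume R: "sequentially_minimizes Z f K x"
  show "sequentially_minimizes X f (insert k0 K) x"
    unfolding sequentially_minimizes_def
  proof (intro conjI ballI impI)
    show "x \<in> X" using assms by auto
    fix k y assume k: "k \<in> insert k0 K" and y: "y \<in> X"
      and eq: "\<forall>j\<in>insert k0 K. j < k \<longrightarrow> f y j = f x j"
    show "f x k \<le> f y k"
    proof (cases "k = k0")
      case True then show ?thesis using assms(2,4) y by auto
    next
      case False
      then have kK: "k \<in> K" using k by auto
      then have "y \<in> Z" using assms(3)[OF kK] assms(5)[OF y assms(2)] eq by auto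
      then show ?thesis using R eq kK unfolding sequentially_minimizes_def by auto
    qed
  qed
qed

lemma sequentially_minimizes_even_indices:
  assumes "\<And>k x y. \<lbrakk>odd k; x \<in> X; y \<in> X\<rbrakk> \<Longrightarrow> f x k = f y k"
  shows "sequentially_minimizes X f {2 * m..} x \<longleftrightarrow> sequentially_minimizes X (\<lambda>y p. f y (2 * p)) {m..} x"
proof -
  have "sequentially_minimizes X f {2 * m..} x \<longleftrightarrow> sequentially_minimizes X f ((*) 2 ` {m..}) x"
  proof (rule sequentially_minimizes_index_mono)
    fix k x y assume "k \<in> {2 * m..} - (*) 2 ` {m..}" "x \<in> X" "y \<in> X"
    moreover have "even k \<Longrightarrow> k \<ge> 2 * m \<Longrightarrow> k \<in> (*) 2 ` {m..}" by (elim evenE) auto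
    ultimately show "f x k = f y k" by (intro assms) auto
  qed auto
  also have "\<dots> \<longleftrightarrow> sequentially_minimizes X (\<lambda>y p. f y (2 * p)) {m..} x"
    unfolding sequentially_minimizes_def by auto
  finally show ?thesis .
qed

text \<open>A positive factor depending on the index alone preserves every comparison. Partners in
  both directions suffice, without a bijection: several even sets can share the moments of one
  binary matrix.\<close>

lemma sequentially_minimizes_transfer:
  fixes c :: "nat \<Rightarrow> real"
  assumes "\<And>k. k \<in> K \<Longrightarrow> c k > 0" and "x \<in> X" "y \<in> Y"
    and xy: "\<And>k. k \<in> K \<Longrightarrow> f x k = c k * g y k"
    and XY: "\<And>x'. x' \<in> X \<Longrightarrow> \<exists>y'\<in>Y. \<forall>k\<in>K. f x' k = c k * g y' k"
    and YX: "\<And>y'. y' \<in> Y \<Longrightarrow> \<exists>x'\<in>X. \<forall>k\<in>K. f x' k = c k * g y' k"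
  shows "sequentially_minimizes X f K x \<longleftrightarrow> sequentially_minimizes Y g K y"
proof
  assume L: "sequentially_minimizes X f K x"
  show "sequentially_minimizes Y g K y"
    unfolding sequentially_minimizes_def
  proof (intro conjI ballI impI assms(3))
    fix k y' assume k: "k \<in> K" and y': "y' \<in> Y" and eq: "\<forall>j\<in>K. j < k \<longrightarrow> g y' j = g y j"
    obtain x' where x': "x' \<in> X" "\<And>k. k \<in> K \<Longrightarrow> f x' k = c k * g y' k" using YX[OF y'] by auto
    have "\<forall>j\<in>K. j < k \<longrightarrow> f x' j = f x j"
      using x'(2) eq xy by simp
    then have "f x k \<le> f x' k"
      using L k x'(1) unfolding sequentially_minimizes_def by blast
    then show "g y k \<le> g y' k" using x'(2)[OF k] xy[OF k] assms(1)[OF k] by auto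
  qed
next
  assume R: "sequentially_minimizes Y g K y"
  show "sequentially_minimizes X f K x"
    unfolding sequentially_minimizes_def
  proof (intro conjI ballI impI assms(2))
    fix k x' assume k: "k \<in> K" and x': "x' \<in> X" and eq: "\<forall>j\<in>K. j < k \<longrightarrow> f x' j = f x j"
    obtain y' where y': "y' \<in> Y" "\<And>k. k \<in> K \<Longrightarrow> f x' k = c k * g y' k" using XY[OF x'] by auto
    have "g y' j = g y j" if "j \<in> K" "j < k" for j
      using eq y'(2)[of j] xy[of j] assms(1)[of j] that by auto
    then have "g y k \<le> g y' k"
      using R k y' unfolding sequentially_minimizes_def by auto
    then show "f x k \<le> f x' k" using y'(2)[OF k] xy[OF k] assms(1)[OF k] by auto
  qed
qed

section \<open>Krawtchouk polynomials and wordlength patterns\<close>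

text \<open>Krawtchouk polynomials in the variable \<open>x = m - 2 * w\<close>, the sum of
  \<open>m\<close> signs of which \<open>w\<close> are negative. The parameter is real, so
  \<open>m - k\<close> in the three-term recurrence is not truncated.\<close>

fun kraw :: "real \<Rightarrow> nat \<Rightarrow> real poly" where
  "kraw m 0 = 1"
| "kraw m (Suc 0) = [:0, 1:]"
| "kraw m (Suc (Suc k)) =
     smult (1 / (k + 2)) (pCons 0 (kraw m (Suc k)) - smult (m - k) (kraw m k))"

lemma poly_kraw_Suc_Suc:
  "(k + 2) * poly (kraw m (Suc (Suc k))) x = x * poly (kraw m (Suc k)) x - (m - k) * poly (kraw m k) x"
  by simp

lemma degree_kraw: "degree (kraw m k) \<le> k"
  by (induction m k rule: kraw.induct)
     (auto intro!: order.trans[OF degree_smult_le] degree_diff_le order.trans[OF degree_pCons_le])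

text \<open>By the recurrence the leading coefficient is the reciprocal of \<open>k\<close>
  factorial. Its sign makes the \<open>k\<close>-th wordlength increase with the \<open>k\<close>-th
  moment once the lower moments are fixed.\<close>

lemma coeff_kraw_pos: "coeff (kraw m k) k > 0"
proof (induction m k rule: kraw.induct)
  case (3 m k)
  have "coeff (kraw m k) (Suc (Suc k)) = 0"
    using degree_kraw[of m k] by (intro coeff_eq_0) auto
  then show ?case using 3 by simp
qed auto

lemma coeff_kraw_odd: "odd (k + j) \<Longrightarrow> coeff (kraw m k) j = 0"
proof (induction m k arbitrary: j rule: kraw.induct)
  case (2 m)
  then show ?case by (cases j) (auto simp: coeff_pCons elim: oddE split: nat.splits)
next
  case (3 m k)
  then show ?case by (cases j) (auto simp: coeff_pCons)
qed (auto simp: coeff_1 odd_pos)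

text \<open>Adjoining a sign \<open>+1\<close> to \<open>m\<close> signs with sum \<open>x\<close>
  turns the elementary symmetric sums into sums of two consecutive ones. The identity holds for all
  real \<open>m\<close> and \<open>x\<close> and follows from the recurrence.\<close>

lemma poly_kraw_plus_one:
  "poly (kraw (m + 1) (Suc k)) (x + 1) = poly (kraw m (Suc k)) x + poly (kraw m k) x"
proof (induction k rule: induct_nat_012)
  case 0 then show ?case by simp
next
  case 1
  show ?case using poly_kraw_Suc_Suc[of 0 "m + 1" "x + 1"] poly_kraw_Suc_Suc[of 0 m x]
    by (simp add: field_simps)
next
  case (ge2 k)
  let ?p = "\<lambda>k. poly (kraw m k) x"
  have "(real k + 3) * poly (kraw (m + 1) (Suc (Suc (Suc k)))) (x + 1)
      = (x + 1) * (?p (Suc (Suc k)) + ?p (Suc k)) - (m - k) * (?p (Suc k) + ?p k)"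
    using poly_kraw_Suc_Suc[of "Suc k" "m + 1" "x + 1"] ge2 by (simp add: add.commute del: kraw.simps)
  also have "\<dots> = (real k + 3) * (?p (Suc (Suc (Suc k))) + ?p (Suc (Suc k)))"
    using poly_kraw_Suc_Suc[of "Suc k" m x] poly_kraw_Suc_Suc[of k m x]
    by (simp add: algebra_simps del: kraw.simps)
  finally show ?case by (simp del: kraw.simps)
qed

section \<open>Elementary symmetric sums of signs\<close>

definition esum :: "nat \<Rightarrow> 'c set \<Rightarrow> ('c \<Rightarrow> real) \<Rightarrow> real" where
  "esum k F y = (\<Sum>H | H \<subseteq> F \<and> card H = k. \<Prod>c\<in>H. y c)"

lemma esum_0: "finite F \<Longrightarrow> esum 0 F y = 1"
proof -
  assume "finite F"
  then have "{H. H \<subseteq> F \<and> card H = 0} = {{}}" by (auto dest: finite_subset)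
  then show ?thesis by (simp add: esum_def)
qed

lemma esum_empty_Suc: "esum (Suc k) {} y = 0"
proof -
  have "{H :: 'a set. H \<subseteq> {} \<and> card H = Suc k} = {}" by auto
  then show ?thesis unfolding esum_def by (metis sum.empty)
qed

lemma esum_insert:
  assumes "finite F" "a \<notin> F"
  shows "esum (Suc k) (insert a F) y = esum (Suc k) F y + y a * esum k F y"
proof -
  let ?A = "{H. H \<subseteq> F \<and> card H = Suc k}" and ?B = "{H. H \<subseteq> F \<and> card H = k}"
  have fin: "finite ?A" "finite ?B" using assms by auto
  have split: "{H. H \<subseteq> insert a F \<and> card H = Suc k} = ?A \<union> insert a ` ?B" (is "?L = ?R")
  proof
    have "card (insert a H) = Suc (card H)" if "H \<subseteq> F" for H
      using that assms by (intro card_insert_disjoint) (auto intro: finite_subset)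
    then show "?R \<subseteq> ?L" by auto
    show "?L \<subseteq> ?R"
    proof
      fix H assume H: "H \<in> ?L"
      show "H \<in> ?R"
      proof (cases "a \<in> H")
        case True
        then have "H = insert a (H - {a})" by auto
        moreover have "H - {a} \<in> ?B" using H True by auto
        ultimately show ?thesis by blast
      next
        case False then show ?thesis using H by auto
      qed
    qed
  qed
  have inj: "inj_on (insert a) ?B" using assms by (auto simp: inj_on_def)
  have "esum (Suc k) (insert a F) y = (\<Sum>H\<in>?A. prod y H) + (\<Sum>H\<in>insert a ` ?B. prod y H)"
    unfolding esum_def split using assms fin by (intro sum.union_disjoint) auto
  also have "(\<Sum>H\<in>insert a ` ?B. prod y H) = (\<Sum>H\<in>?B. y a * prod y H)"
    unfolding sum.reindex[OF inj] o_def using assms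
    by (intro sum.cong refl) (auto intro!: prod.insert intro: finite_subset)
  finally show ?thesis by (simp add: esum_def sum_distrib_left)
qed

lemma esum_1:
  assumes "finite F"
  shows "esum (Suc 0) F y = sum y F"
  using assms by (induction F) (auto simp: esum_empty_Suc esum_insert esum_0)

text \<open>Multiply \<open>sum y F\<close> by \<open>esum (Suc k) F y\<close>. A factor outside the
  chosen set produces each set of size \<open>k + 2\<close> exactly \<open>k + 2\<close> times; a
  factor inside it squares to 1 and leaves a set of size \<open>k\<close>, each arising
  \<open>card F - k\<close> times. The formal argument is by induction on \<open>F\<close>.\<close>

lemma esum_rec:
  assumes "finite F" "\<And>c. c \<in> F \<Longrightarrow> y c ^ 2 = 1"
  shows "(k + 2) * esum (Suc (Suc k)) F y = sum y F * esum (Suc k) F y - (real (card F) - k) * esum k F y"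
  using assms
proof (induction F arbitrary: k)
  case empty
  then show ?case by (cases k) (auto simp: esum_empty_Suc esum_0)
next
  case (insert a F)
  have ya: "y a * (y a * z) = z" for z :: real
    using insert.prems[of a] by (simp add: power2_eq_square flip: mult.assoc)
  have IH: "(k + 2) * esum (Suc (Suc k)) F y = sum y F * esum (Suc k) F y - (real (card F) - k) * esum k F y" for k
    using insert by auto
  show ?case
  proof (cases k)
    case 0
    then show ?thesis using IH[of 0] insert(1,2) ya[of 1]
      by (simp add: esum_insert esum_0 esum_1 algebra_simps)
  next
    case (Suc l)
    \<comment> \<open>The coefficient \<open>k + 2\<close> of \<open>y a * esum (Suc k) F y\<close>
      is split as \<open>(l + 2) + 1\<close>, so that the induction hypothesis applies both at
      \<open>k\<close> and at \<open>l\<close>.\<close>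
    have "(real k + 2) * esum (Suc (Suc k)) (insert a F) y =
       (real k + 2) * esum (Suc (Suc k)) F y + y a * ((real l + 2) * esum (Suc (Suc l)) F y) + y a * esum k F y * 1
         + y a * esum (Suc k) F y - y a * esum k F y"
      using insert(1,2) Suc by (simp add: esum_insert algebra_simps)
    also have "\<dots> = (sum y F * esum (Suc k) F y - (real (card F) - k) * esum k F y)
       + y a * (sum y F * esum k F y - (real (card F) - l) * esum l F y) + y a * esum (Suc k) F y"
      by (simp only: IH) (simp add: Suc)
    also have "\<dots> = sum y (insert a F) * esum (Suc k) (insert a F) y
        - (real (card (insert a F)) - k) * esum k (insert a F) y"
      using insert(1,2) Suc ya by (simp add: esum_insert algebra_simps)
    finally show ?thesis .
  qed
qed

lemma esum_eq_kraw:
  assumes "finite F" "\<And>c. c \<in> F \<Longrightarrow> y c ^ 2 = 1"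
  shows "esum k F y = poly (kraw (card F) k) (sum y F)"
proof (induction k rule: induct_nat_012)
  case (ge2 k)
  have "(real k + 2) * esum (Suc (Suc k)) F y = (real k + 2) * poly (kraw (card F) (Suc (Suc k))) (sum y F)"
    using esum_rec[OF assms, of "\<lambda>c. c" k] poly_kraw_Suc_Suc[of k "card F" "sum y F"] ge2 by (simp add: add.commute del: kraw.simps)
  moreover have "real k + 2 \<noteq> 0" by linarith
  ultimately show ?case by (metis mult_cancel_left)
qed (auto simp: esum_0 esum_1 assms)

text \<open>Squaring the sum over runs gives a sum over pairs of runs; summing over \<open>H\<close>
  first yields an elementary symmetric sum of the signs \<open>entry D u c * entry D w c\<close>,
  hence a Krawtchouk value. It depends on \<open>dif u w\<close> only, so the double sum collapses
  to a single one. The map \<open>dif\<close> is subtraction for quaternary designs and addition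
  modulo 2 for regular ones.\<close>

lemma wordlength_kraw:
  fixes D :: "('r, 'c) design"
  assumes fin: "finite (runs D)" "finite (factors D)"
    and pm: "\<And>u c. \<lbrakk>u \<in> runs D; c \<in> factors D\<rbrakk> \<Longrightarrow> entry D u c ^ 2 = 1"
    and bij: "\<And>w. w \<in> runs D \<Longrightarrow> bij_betw (\<lambda>u. dif u w) (runs D) (runs D)"
    and \<sigma>: "\<And>u w. \<lbrakk>u \<in> runs D; w \<in> runs D\<rbrakk> \<Longrightarrow>
      (\<Sum>c\<in>factors D. entry D u c * entry D w c) = \<sigma> (dif u w)"
  shows "wordlength D k = (\<Sum>u\<in>runs D. poly (kraw (card (factors D)) k) (\<sigma> u)) / card (runs D)"
proof -
  let ?N = "real (card (runs D))" and ?Hs = "{H. H \<subseteq> factors D \<and> card H = k}"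
  let ?p = "poly (kraw (card (factors D)) k)"
  have "wordlength D k = (\<Sum>H\<in>?Hs. (\<Sum>u\<in>runs D. \<Prod>c\<in>H. entry D u c)\<^sup>2) / ?N\<^sup>2"
    by (simp add: wordlength_def rho_def power_divide sum_divide_distrib[symmetric])
  also have "(\<Sum>H\<in>?Hs. (\<Sum>u\<in>runs D. \<Prod>c\<in>H. entry D u c)\<^sup>2)
     = (\<Sum>H\<in>?Hs. \<Sum>w\<in>runs D. \<Sum>u\<in>runs D. \<Prod>c\<in>H. entry D u c * entry D w c)"
    by (simp add: power2_eq_square sum_product prod.distrib) (intro sum.cong refl sum.swap)
  also have "\<dots> = (\<Sum>w\<in>runs D. \<Sum>u\<in>runs D. esum k (factors D) (\<lambda>c. entry D u c * entry D w c))"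
    unfolding esum_def by (subst sum.swap) (intro sum.cong refl, rule sum.swap)
  also have "\<dots> = (\<Sum>w\<in>runs D. \<Sum>u\<in>runs D. ?p (\<sigma> (dif u w)))"
    using pm by (intro sum.cong refl) (simp add: esum_eq_kraw fin \<sigma> power_mult_distrib)
  also have "\<dots> = (\<Sum>w\<in>runs D. \<Sum>u\<in>runs D. ?p (\<sigma> u))"
    by (intro sum.cong refl sum.reindex_bij_betw bij)
  finally show ?thesis by (simp add: power2_eq_square)
qed

lemma wordlength_eq_0:
  assumes "finite (factors D)" "card (factors D) < k"
  shows "wordlength D k = 0"
proof -
  have "{H. H \<subseteq> factors D \<and> card H = k} = {}"
    using assms(2) by (auto dest: card_mono[OF assms(1)])
  then show ?thesis unfolding wordlength_def by (metis sum.empty)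
qed

lemma sum_poly_moments:
  assumes "degree p \<le> k"
  shows "(\<Sum>u\<in>U. poly p (f u :: real)) = coeff p k * (\<Sum>u\<in>U. f u ^ k) + (\<Sum>j<k. coeff p j * (\<Sum>u\<in>U. f u ^ j))"
proof -
  have "poly p z = (\<Sum>j\<le>k. coeff p j * z ^ j)" for z
    unfolding poly_altdef using assms by (intro sum.mono_neutral_left) (auto simp: coeff_eq_0)
  then have "(\<Sum>u\<in>U. poly p (f u)) = (\<Sum>u\<in>U. \<Sum>j\<le>k. coeff p j * f u ^ j)"
    by simp
  also have "\<dots> = (\<Sum>j\<le>k. coeff p j * (\<Sum>u\<in>U. f u ^ j))"
    unfolding sum_distrib_left by (rule sum.swap)
  finally show ?thesis by (simp add: lessThan_Suc_atMost[symmetric])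
qed

section \<open>Characters on the integers modulo 4\<close>

lemma Z4_cases [case_names 0 1 2 3]:
  fixes a :: 4
  obtains "a = 0" | "a = 1" | "a = 2" | "a = 3"
proof (cases a)
  case (of_int z)
  then have "z \<in> {0, 1, 2, 3}" by auto
  then show ?thesis using of_int that by auto
qed

text \<open>The real part of \<open>i\<close> to the power \<open>a\<close>.\<close>

definition chi :: "4 \<Rightarrow> real" where
  "chi a = (if a = 0 then 1 else if a = 2 then -1 else 0)"

lemma chi_0 [simp]: "chi 0 = 1"
  by (simp add: chi_def)

lemma chi_add_2: "chi (a + 2) = - chi a"
  by (cases a rule: Z4_cases) (simp_all add: chi_def)

lemma chi_uminus [simp]: "chi (- a) = chi a"
  by (cases a rule: Z4_cases) (simp_all add: chi_def)

lemma chi_mult: "2 * (chi a * chi b) = chi (a + b) + chi (a - b)"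
  by (cases a rule: Z4_cases; cases b rule: Z4_cases; simp add: chi_def)

text \<open>For even \<open>b\<close> the power of i with exponent \<open>b\<close> is real, so it
  can be pulled out of the real part.\<close>

lemma chi_add_even: "even_Z4 b \<Longrightarrow> chi (a + b) = chi a * chi b"
  by (cases a rule: Z4_cases; cases b rule: Z4_cases; simp add: chi_def even_Z4_def)

lemma chi_even_power: "\<lbrakk>even k; k > 0\<rbrakk> \<Longrightarrow> chi a ^ k = (if even_Z4 a then 1 else 0)"
  by (cases a rule: Z4_cases) (simp_all add: chi_def even_Z4_def)

text \<open>The Gray map is an isometry, though not a homomorphism: inner products of runs depend
  only on the difference of the runs.\<close>

lemma gray_products: "fst (gray a) * fst (gray b) + snd (gray a) * snd (gray b) = 2 * chi (a - b)"
  by (cases a rule: Z4_cases; cases b rule: Z4_cases; simp add: chi_def gray_def)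

lemma even_Z4_0 [simp]: "even_Z4 0" and even_Z4_2 [simp]: "even_Z4 2"
  by (simp_all add: even_Z4_def)

lemma even_Z4_add_iff: "even_Z4 (a + b) \<longleftrightarrow> (even_Z4 a \<longleftrightarrow> even_Z4 b)"
  by (cases a rule: Z4_cases; cases b rule: Z4_cases; simp add: even_Z4_def)

lemma even_Z4_uminus [simp]: "even_Z4 (- a) \<longleftrightarrow> even_Z4 a"
  by (cases a rule: Z4_cases) (simp_all add: even_Z4_def)

lemma even_Z4_diff_iff: "even_Z4 (a - b) \<longleftrightarrow> (even_Z4 a \<longleftrightarrow> even_Z4 b)"
  using even_Z4_add_iff[of a "- b"] by simp

lemma even_Z4_mult: "even_Z4 a \<Longrightarrow> even_Z4 (a * b)"
  by (cases a rule: Z4_cases; cases b rule: Z4_cases; simp add: even_Z4_def)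

lemma even_Z4_mult_even: "\<lbrakk>even_Z4 a; even_Z4 b\<rbrakk> \<Longrightarrow> a * b = 0"
  by (cases a rule: Z4_cases; cases b rule: Z4_cases; simp add: even_Z4_def)

lemma even_Z4_sum: "(\<And>i. i \<in> I \<Longrightarrow> even_Z4 (f i)) \<Longrightarrow> even_Z4 (sum f I)"
  by (induction I rule: infinite_finite_induct) (auto simp: even_Z4_add_iff)

section \<open>Even vectors and orthogonality of characters\<close>

definition even_vecs :: "nat \<Rightarrow> 4 vec set" where
  "even_vecs n = {u \<in> carrier_vec n. \<forall>i<n. even_Z4 (u $ i)}"

lemma even_vecs_carrier: "u \<in> even_vecs n \<Longrightarrow> u \<in> carrier_vec n"
  by (simp add: even_vecs_def)

lemma even_vecs_index: "u \<in> even_vecs n \<Longrightarrow> i < n \<Longrightarrow> even_Z4 (u $ i)"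
  by (simp add: even_vecs_def)

lemma even_vecs_add: "u \<in> even_vecs n \<Longrightarrow> w \<in> even_vecs n \<Longrightarrow> u + w \<in> even_vecs n"
  by (auto simp: even_vecs_def even_Z4_add_iff)

lemma even_vecs_diff: "u \<in> even_vecs n \<Longrightarrow> w \<in> even_vecs n \<Longrightarrow> u - w \<in> even_vecs n"
  by (auto simp: even_vecs_def even_Z4_diff_iff)

lemma even_vecs_diff_iff_add:
  "\<lbrakk>g \<in> carrier_vec n; h \<in> carrier_vec n\<rbrakk> \<Longrightarrow> g - h \<in> even_vecs n \<longleftrightarrow> g + h \<in> even_vecs n"
  by (auto simp: even_vecs_def even_Z4_diff_iff even_Z4_add_iff)

lemma even_vecs_zero: "0\<^sub>v n \<in> even_vecs n"
  by (simp add: even_vecs_def)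

lemma scalar_prod_even:
  assumes "u \<in> carrier_vec n" "g \<in> even_vecs n"
  shows "even_Z4 (u \<bullet> g)"
  unfolding scalar_prod_def using assms
  by (intro even_Z4_sum) (auto simp: even_vecs_def mult.commute intro: even_Z4_mult)

lemma scalar_prod_even_even:
  assumes "u \<in> even_vecs n" "g \<in> even_vecs n"
  shows "u \<bullet> g = 0"
  unfolding scalar_prod_def using assms
  by (intro sum.neutral ballI even_Z4_mult_even) (auto simp: even_vecs_def)

lemma card_vecs_over:
  assumes "finite A"
  shows "card {v \<in> carrier_vec n. \<forall>i<n. v $ i \<in> A} = card A ^ n"
    and "finite {v \<in> carrier_vec n. \<forall>i<n. v $ i \<in> A}"
proof -
  let ?V = "{v \<in> carrier_vec n. \<forall>i<n. v $ i \<in> A}"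
  have bij: "bij_betw (vec n) ({..<n} \<rightarrow>\<^sub>E A) ?V"
  proof (rule bij_betw_byWitness[where f' = "\<lambda>v. restrict (\<lambda>i. v $ i) {..<n}"])
    show "\<forall>f\<in>{..<n} \<rightarrow>\<^sub>E A. restrict (\<lambda>i. vec n f $ i) {..<n} = f"
      by (auto simp: fun_eq_iff PiE_def extensional_def)
    show "\<forall>v\<in>?V. vec n (restrict (\<lambda>i. v $ i) {..<n}) = v" by auto
    show "vec n ` ({..<n} \<rightarrow>\<^sub>E A) \<subseteq> ?V"
      by (rule image_subsetI) (simp add: PiE_iff)
    show "(\<lambda>v. restrict (\<lambda>i. v $ i) {..<n}) ` ?V \<subseteq> {..<n} \<rightarrow>\<^sub>E A"
      by (rule image_subsetI) (simp add: restrict_PiE_iff)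
  qed
  show "card ?V = card A ^ n"
    using bij_betw_same_card[OF bij] by (simp add: card_PiE)
  show "finite ?V"
    using bij_betw_finite[OF bij] finite_PiE[of "{..<n}" "\<lambda>_. A"] assms by simp
qed

lemma card_carrier_vec_Z4: "card (carrier_vec n :: 4 vec set) = 4 ^ n"
  and finite_carrier_vec_Z4 [simp]: "finite (carrier_vec n :: 4 vec set)"
  using card_vecs_over[of "UNIV :: 4 set" n] by simp_all

lemma card_even_vecs: "card (even_vecs n) = 2 ^ n"
  and finite_even_vecs [simp]: "finite (even_vecs n)"
proof -
  have "even_vecs n = {v \<in> carrier_vec n. \<forall>i<n. v $ i \<in> {0, 2}}"
    by (auto simp: even_vecs_def even_Z4_def)
  then show "card (even_vecs n) = 2 ^ n" "finite (even_vecs n)"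
    using card_vecs_over[of "{0, 2 :: 4}" n] by (simp_all add: numeral_2_eq_2)
qed

lemma sum_shift_vec:
  fixes G :: "4 vec set" and F :: "4 vec \<Rightarrow> real"
  assumes "G = carrier_vec n \<or> G = even_vecs n" "w \<in> G"
  shows "bij_betw (\<lambda>u. u + w) G G" and "bij_betw (\<lambda>u. u - w) G G"
    and "(\<Sum>u\<in>G. F (u + w)) = (\<Sum>u\<in>G. F u)"
proof -
  have G: "u \<in> carrier_vec n" "u + w \<in> G" "u - w \<in> G" if "u \<in> G" for u
    using assms that by (auto intro: even_vecs_add even_vecs_diff even_vecs_carrier)
  have eq: "u + w - w = u" "u - w + w = u" if "u \<in> G" for u
    using G(1)[OF that] G(1)[OF assms(2)] by (intro eq_vecI; auto)+
  show bij: "bij_betw (\<lambda>u. u + w) G G"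
    by (rule bij_betw_byWitness[where f' = "\<lambda>u. u - w"]) (use G eq in auto)
  show "bij_betw (\<lambda>u. u - w) G G"
    by (rule bij_betw_byWitness[where f' = "\<lambda>u. u + w"]) (use G eq in auto)
  show "(\<Sum>u\<in>G. F (u + w)) = (\<Sum>u\<in>G. F u)"
    by (rule sum.reindex_bij_betw[OF bij])
qed

text \<open>Translation by \<open>w\<close> permutes \<open>G\<close> and adds 2 to
  \<open>u \<bullet> g\<close>, which reverses the sign of every term.\<close>

lemma sum_chi_eq_0:
  assumes "G = carrier_vec n \<or> G = even_vecs n" "w \<in> G" "g \<in> carrier_vec n" "w \<bullet> g = 2"
  shows "(\<Sum>u\<in>G. chi (u \<bullet> g)) = 0"
proof -
  have "(\<Sum>u\<in>G. chi (u \<bullet> g)) = (\<Sum>u\<in>G. chi ((u + w) \<bullet> g))"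
    using sum_shift_vec(3)[OF assms(1,2), of "\<lambda>u. chi (u \<bullet> g)"] by simp
  also have "\<dots> = (\<Sum>u\<in>G. - chi (u \<bullet> g))"
    using assms by (intro sum.cong refl)
      (auto simp: add_scalar_prod_distrib[of _ n] chi_add_2 even_vecs_carrier)
  finally show ?thesis by (simp add: sum_negf)
qed

lemma unit_smult_scalar_prod:
  fixes g :: "4 vec"
  assumes "g \<in> carrier_vec n" "i < n"
  shows "(a \<cdot>\<^sub>v unit_vec n i) \<bullet> g = a * g $ i"
  using assms by (simp add: smult_scalar_prod_distrib[of _ n] scalar_prod_left_unit)

lemma sum_chi_carrier:
  assumes "g \<in> carrier_vec n"
  shows "(\<Sum>u\<in>carrier_vec n. chi (u \<bullet> g)) = (if g = 0\<^sub>v n then 4 ^ n else 0)"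
proof (cases "g = 0\<^sub>v n")
  case True
  then show ?thesis by (simp add: scalar_prod_right_zero card_carrier_vec_Z4)
next
  case False
  then obtain i where i: "i < n" "g $ i \<noteq> 0"
    using assms by (metis carrier_vecD eq_vecI index_zero_vec)
  \<comment> \<open>The multiplier is \<open>a = 1\<close> if the entry is 2 and
    \<open>a = 2\<close> if the entry is odd.\<close>
  obtain a where "a * g $ i = 2"
    using i(2) by (cases "g $ i" rule: Z4_cases) (auto intro: that[of 1] that[of 2])
  then show ?thesis
    using False i assms sum_chi_eq_0[of "carrier_vec n" n "a \<cdot>\<^sub>v unit_vec n i" g]
    by (simp add: unit_smult_scalar_prod)
qed

lemma sum_chi_even:
  assumes "g \<in> carrier_vec n"
  shows "(\<Sum>u\<in>even_vecs n. chi (u \<bullet> g)) = (if g \<in> even_vecs n then 2 ^ n else 0)"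
proof (cases "g \<in> even_vecs n")
  case True
  then show ?thesis by (simp add: scalar_prod_even_even card_even_vecs)
next
  case False
  then obtain i where i: "i < n" "\<not> even_Z4 (g $ i)"
    using assms by (auto simp: even_vecs_def)
  then have "2 * g $ i = 2"
    by (cases "g $ i" rule: Z4_cases) auto
  moreover have "2 \<cdot>\<^sub>v unit_vec n i \<in> even_vecs n"
    using i by (auto simp: even_vecs_def unit_vec_def)
  ultimately show ?thesis
    using False i assms sum_chi_eq_0[of "even_vecs n" n "2 \<cdot>\<^sub>v unit_vec n i" g]
    by (simp add: unit_smult_scalar_prod)
qed

section \<open>The set \<open>Omega\<close> as one half of the vectors that are not even\<close>

lemma Omega_carrier: "g \<in> Omega n \<Longrightarrow> g \<in> carrier_vec n"
  by (simp add: Omega_def)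

lemma finite_Omega [simp]: "finite (Omega n)"
  by (rule finite_subset[OF _ finite_carrier_vec_Z4[of n]]) (auto simp: Omega_def)

lemma Omega_not_even: "g \<in> Omega n \<Longrightarrow> g \<notin> even_vecs n"
  by (auto simp: Omega_def even_vecs_def even_Z4_def)

lemma uminus_Omega_disjoint:
  assumes "g \<in> Omega n" "h \<in> Omega n"
  shows "h \<noteq> - g"
proof
  assume h: "h = - g"
  obtain i where i: "i < n" "g $ i = 1" "\<And>j. j < i \<Longrightarrow> even_Z4 (g $ j)"
    using assms(1) by (auto simp: Omega_def)
  obtain l where l: "l < n" "h $ l = 1" "\<And>j. j < l \<Longrightarrow> even_Z4 (h $ j)"
    using assms(2) by (auto simp: Omega_def)
  have hj: "h $ j = - (g $ j)" if "j < n" for j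
    using that carrier_vecD[OF Omega_carrier[OF assms(1)]] by (simp add: h)
  have "\<not> i < l" using l(3)[of i] i hj[of i] by (auto simp: even_Z4_def)
  moreover have "\<not> l < i" using i(3)[of l] l hj[of l] by (auto simp: even_Z4_def)
  ultimately have "l = i" by simp
  then show False using l(2) i hj[of i] by simp
qed

text \<open>The odd residues are 1 and 3 = -1, so a vector whose first odd entry is not 1 becomes an
  element of \<open>Omega\<close> after negation.\<close>

lemma odd_vecs_eq: "carrier_vec n - even_vecs n = Omega n \<union> uminus ` Omega n"
proof (intro equalityI subsetI)
  fix g assume g: "g \<in> carrier_vec n - even_vecs n"
  define i where "i = (LEAST i. i < n \<and> \<not> even_Z4 (g $ i))"
  have "\<exists>i. i < n \<and> \<not> even_Z4 (g $ i)" using g by (auto simp: even_vecs_def)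
  then have i: "i < n" "\<not> even_Z4 (g $ i)" unfolding i_def by (metis (mono_tags, lifting) LeastI_ex)+
  have less: "even_Z4 (g $ j)" if "j < i" for j
    using not_less_Least[of j "\<lambda>i. i < n \<and> \<not> even_Z4 (g $ i)"] that i(1) unfolding i_def[symmetric] by auto
  from i(2) consider "g $ i = 1" | "g $ i = 3"
    by (cases "g $ i" rule: Z4_cases) (auto simp: even_Z4_def)
  then show "g \<in> Omega n \<union> uminus ` Omega n"
  proof cases
    case 1
    then show ?thesis using g i less by (auto simp: Omega_def)
  next
    case 2
    have "- g \<in> Omega n"
      unfolding Omega_def using g i less 2 by (auto intro!: exI[of _ i])
    then show ?thesis using g by (auto intro!: image_eqI[of _ _ "- g"])
  qed
next
  fix g assume "g \<in> Omega n \<union> uminus ` Omega n"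
  then obtain h where h: "h \<in> Omega n" "g = h \<or> g = - h" by auto
  have "- h \<in> even_vecs n \<longleftrightarrow> h \<in> even_vecs n"
    using Omega_carrier[OF h(1)] by (auto simp: even_vecs_def)
  then show "g \<in> carrier_vec n - even_vecs n"
    using h Omega_not_even[OF h(1)] Omega_carrier[OF h(1)] by auto
qed

text \<open>This is the sum of the entries of run \<open>u\<close> in the design arising from
  \<open>S\<close>: the Gray pair of \<open>a\<close> has sum \<open>2 * chi a\<close>.\<close>

definition colsum :: "4 vec set \<Rightarrow> 4 vec \<Rightarrow> real" where
  "colsum S u = (\<Sum>g\<in>S. 2 * chi (u \<bullet> g))"

text \<open>As \<open>chi\<close> is an even function, \<open>Omega\<close> and its negative
  contribute equally. Twice the sum over \<open>Omega\<close> is therefore the character sum over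
  all vectors minus the one over even vectors, and orthogonality evaluates both.\<close>

lemma colsum_Omega:
  assumes u: "u \<in> carrier_vec n"
  shows "colsum (Omega n) u = (if u = 0\<^sub>v n then 4 ^ n else 0) - (if u \<in> even_vecs n then 2 ^ n else 0)"
proof -
  have inj: "inj_on uminus (Omega n)"
    by (auto simp: inj_on_def)
  have sub: "even_vecs n \<subseteq> carrier_vec n" by (auto simp: even_vecs_def)
  have comm: "u \<bullet> g = g \<bullet> u" if "g \<in> carrier_vec n" for g
    using comm_scalar_prod[OF u that] .
  have "(\<Sum>g\<in>carrier_vec n. chi (u \<bullet> g)) - (\<Sum>g\<in>even_vecs n. chi (u \<bullet> g))
      = (\<Sum>g\<in>carrier_vec n - even_vecs n. chi (u \<bullet> g))"
    using sub by (simp add: sum_diff)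
  also have "\<dots> = (\<Sum>g\<in>Omega n. chi (u \<bullet> g)) + (\<Sum>g\<in>uminus ` Omega n. chi (u \<bullet> g))"
    unfolding odd_vecs_eq using uminus_Omega_disjoint by (intro sum.union_disjoint) auto
  also have "(\<Sum>g\<in>uminus ` Omega n. chi (u \<bullet> g)) = (\<Sum>g\<in>Omega n. chi (u \<bullet> g))"
    unfolding sum.reindex[OF inj] o_def
  proof (intro sum.cong refl)
    fix g assume "g \<in> Omega n"
    then show "chi (u \<bullet> - g) = chi (u \<bullet> g)"
      using carrier_vecD[OF u] carrier_vecD[OF Omega_carrier, of g n] by simp
  qed
  also have "(\<Sum>g\<in>carrier_vec n. chi (u \<bullet> g)) = (if u = 0\<^sub>v n then 4 ^ n else 0)"
    using sum_chi_carrier[OF u] comm by simp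
  also have "(\<Sum>g\<in>even_vecs n. chi (u \<bullet> g)) = (if u \<in> even_vecs n then 2 ^ n else 0)"
    using sum_chi_even[OF u] comm even_vecs_carrier by simp
  finally show ?thesis by (simp add: colsum_def sum_distrib_left)
qed

lemma colsum_zero:
  assumes "S \<subseteq> Omega n"
  shows "colsum S (0\<^sub>v n) = 2 * card S"
proof -
  have "chi (0\<^sub>v n \<bullet> g) = 1" if "g \<in> S" for g
    using that assms Omega_carrier by (auto simp: scalar_prod_left_zero)
  then show ?thesis by (simp add: colsum_def)
qed

lemma card_Omega: "real (2 * card (Omega n)) = 4 ^ n - 2 ^ n"
  using colsum_zero[of "Omega n" n] colsum_Omega[of "0\<^sub>v n" n] even_vecs_zero[of n] by simp

lemma wordlength_QC:
  assumes "S \<subseteq> Omega n"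
  shows "wordlength (QC_design n S) k
    = (\<Sum>u\<in>carrier_vec n. poly (kraw (2 * card S) k) (colsum S u)) / 4 ^ n"
proof -
  have fin: "finite S" using assms finite_Omega finite_subset by blast
  have "wordlength (QC_design n S) k = (\<Sum>u\<in>runs (QC_design n S).
      poly (kraw (card (factors (QC_design n S))) k) (colsum S u)) / card (runs (QC_design n S))"
  proof (rule wordlength_kraw[where dif = "\<lambda>u w. u - w"])
    show "bij_betw (\<lambda>u. u - w) (runs (QC_design n S)) (runs (QC_design n S))"
      if "w \<in> runs (QC_design n S)" for w
      using that sum_shift_vec(2)[of "carrier_vec n" n w] by (simp add: QC_design_def)
    show "(entry (QC_design n S) u c)\<^sup>2 = 1" for u c
      by (auto simp: QC_design_def gray_def split: prod.split)
    fix u w assume uw: "u \<in> runs (QC_design n S)" "w \<in> runs (QC_design n S)"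
    have "(\<Sum>c\<in>factors (QC_design n S). entry (QC_design n S) u c * entry (QC_design n S) w c)
      = (\<Sum>g\<in>S. \<Sum>b\<in>UNIV. entry (QC_design n S) u (g, b) * entry (QC_design n S) w (g, b))"
      unfolding sum.cartesian_product by (simp add: QC_design_def) (intro sum.cong refl, auto)
    also have "\<dots> = (\<Sum>g\<in>S. 2 * chi (u \<bullet> g - w \<bullet> g))"
      by (simp add: QC_design_def UNIV_bool gray_products[symmetric] add.commute)
    also have "\<dots> = colsum S (u - w)"
      unfolding colsum_def using uw assms Omega_carrier
      by (intro sum.cong refl) (auto simp: QC_design_def minus_scalar_prod_distrib[of _ n])
    finally show "(\<Sum>c\<in>factors (QC_design n S). entry (QC_design n S) u c * entry (QC_design n S) w c)
      = colsum S (u - w)" .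
  qed (use fin in \<open>auto simp: QC_design_def\<close>)
  then show ?thesis
    by (simp add: QC_design_def card_cartesian_product card_carrier_vec_Z4 mult.commute)
qed

section \<open>Moments of complementary designs\<close>

definition moment :: "nat \<Rightarrow> 4 vec set \<Rightarrow> nat \<Rightarrow> real" where
  "moment n S k = (\<Sum>u\<in>carrier_vec n. colsum S u ^ k)"

lemma colsum_square:
  assumes "S \<subseteq> carrier_vec n" "u \<in> carrier_vec n"
  shows "colsum S u ^ 2 = (\<Sum>g\<in>S. \<Sum>h\<in>S. 2 * (chi (u \<bullet> (g + h)) + chi (u \<bullet> (g - h))))"
proof -
  have "colsum S u ^ 2 = (\<Sum>g\<in>S. \<Sum>h\<in>S. 2 * chi (u \<bullet> g) * (2 * chi (u \<bullet> h)))"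
    by (simp add: colsum_def power2_eq_square sum_product)
  also have "\<dots> = (\<Sum>g\<in>S. \<Sum>h\<in>S. 2 * (chi (u \<bullet> (g + h)) + chi (u \<bullet> (g - h))))"
  proof (intro sum.cong refl)
    fix g h assume "g \<in> S" "h \<in> S"
    then have "g \<in> carrier_vec n" "h \<in> carrier_vec n" using assms by auto
    then show "2 * chi (u \<bullet> g) * (2 * chi (u \<bullet> h)) = 2 * (chi (u \<bullet> (g + h)) + chi (u \<bullet> (g - h)))"
      using chi_mult[of "u \<bullet> g" "u \<bullet> h"] assms
      by (simp add: scalar_prod_add_distrib[of _ n] scalar_prod_minus_distrib[of _ n])
  qed
  finally show ?thesis .
qed

lemma colsum_cube:
  assumes "S \<subseteq> carrier_vec n" "u \<in> carrier_vec n"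
  shows "colsum S u ^ 3 = (\<Sum>g\<in>S. \<Sum>h\<in>S. \<Sum>l\<in>S.
    2 * (chi (u \<bullet> (g + h + l)) + chi (u \<bullet> (g + h - l)) + chi (u \<bullet> (g - h + l)) + chi (u \<bullet> (g - h - l))))"
proof -
  have "colsum S u ^ 3 = colsum S u ^ 2 * colsum S u"
    by (simp add: power3_eq_cube power2_eq_square)
  also have "\<dots> = (\<Sum>g\<in>S. \<Sum>h\<in>S. \<Sum>l\<in>S.
      2 * (chi (u \<bullet> (g + h)) + chi (u \<bullet> (g - h))) * (2 * chi (u \<bullet> l)))"
    unfolding colsum_square[OF assms] unfolding colsum_def
    by (simp only: sum_distrib_right) (simp only: sum_distrib_left)
  also have "\<dots> = (\<Sum>g\<in>S. \<Sum>h\<in>S. \<Sum>l\<in>S.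
      2 * (chi (u \<bullet> (g + h + l)) + chi (u \<bullet> (g + h - l)) + chi (u \<bullet> (g - h + l)) + chi (u \<bullet> (g - h - l))))"
  proof (intro sum.cong refl)
    fix g h l assume "g \<in> S" "h \<in> S" "l \<in> S"
    then have c: "g \<in> carrier_vec n" "h \<in> carrier_vec n" "l \<in> carrier_vec n" using assms by auto
    then have eq: "u \<bullet> (a + l) = u \<bullet> a + u \<bullet> l" "u \<bullet> (a - l) = u \<bullet> a - u \<bullet> l"
      if "a \<in> carrier_vec n" for a
      using assms(2) that by (auto simp: scalar_prod_add_distrib[of _ n] scalar_prod_minus_distrib[of _ n])
    have "2 * (chi a + chi b) * (2 * chi c) = 2 * (chi (a + c) + chi (a - c) + chi (b + c) + chi (b - c))"
      for a b c
      using chi_mult[of a c] chi_mult[of b c] by (simp add: distrib_left distrib_right)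
    then show "2 * (chi (u \<bullet> (g + h)) + chi (u \<bullet> (g - h))) * (2 * chi (u \<bullet> l))
      = 2 * (chi (u \<bullet> (g + h + l)) + chi (u \<bullet> (g + h - l)) + chi (u \<bullet> (g - h + l)) + chi (u \<bullet> (g - h - l)))"
      using c eq[of "g + h"] eq[of "g - h"] by simp
  qed
  finally show ?thesis .
qed

lemma sum_colsum_carrier:
  assumes "S \<subseteq> Omega n"
  shows "(\<Sum>u\<in>carrier_vec n. colsum S u) = 0"
proof -
  have "g \<in> carrier_vec n \<and> g \<noteq> 0\<^sub>v n" if "g \<in> S" for g
    using that assms Omega_carrier Omega_not_even even_vecs_zero by blast
  then show ?thesis
    unfolding colsum_def by (subst sum.swap) (simp add: sum_distrib_left[symmetric] sum_chi_carrier)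
qed

lemma sum_colsum_even:
  assumes "S \<subseteq> Omega n"
  shows "(\<Sum>u\<in>even_vecs n. colsum S u) = 0"
proof -
  have "g \<in> carrier_vec n \<and> g \<notin> even_vecs n" if "g \<in> S" for g
    using that assms Omega_carrier Omega_not_even by blast
  then show ?thesis
    unfolding colsum_def by (subst sum.swap) (simp add: sum_distrib_left[symmetric] sum_chi_even)
qed

text \<open>Among all \<open>g + h\<close> and \<open>g - h\<close> only the differences
  \<open>g - g\<close> vanish, because \<open>Omega\<close> contains no two opposite vectors. So the
  second moment depends on the size of \<open>S\<close> alone.\<close>

lemma moment_2:
  assumes S: "S \<subseteq> Omega n"
  shows "moment n S 2 = 2 * 4 ^ n * card S"
proof -
  have fin: "finite S" and SV: "S \<subseteq> carrier_vec n"
    using S finite_Omega finite_subset Omega_carrier by blast+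
  have "moment n S 2 = (\<Sum>u\<in>carrier_vec n. \<Sum>g\<in>S. \<Sum>h\<in>S. 2 * (chi (u \<bullet> (g + h)) + chi (u \<bullet> (g - h))))"
    unfolding moment_def by (intro sum.cong refl colsum_square[OF SV])
  also have "\<dots> = (\<Sum>g\<in>S. \<Sum>h\<in>S. \<Sum>u\<in>carrier_vec n. 2 * (chi (u \<bullet> (g + h)) + chi (u \<bullet> (g - h))))"
    by (subst sum.swap) (intro sum.cong refl sum.swap)
  also have "\<dots> = (\<Sum>g\<in>S. \<Sum>h\<in>S. if h = g then 2 * 4 ^ n else 0)"
  proof (intro sum.cong refl)
    fix g h assume gh: "g \<in> S" "h \<in> S"
    then have c: "g \<in> carrier_vec n" "h \<in> carrier_vec n" using SV by auto
    have "g + h \<noteq> 0\<^sub>v n"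
    proof
      assume z: "g + h = 0\<^sub>v n"
      have "h = - g"
      proof (rule eq_vecI)
        fix i assume "i < dim_vec (- g)"
        moreover from this have "(g + h) $ i = 0" unfolding z using c by simp
        ultimately show "h $ i = (- g) $ i" using c by (simp add: eq_neg_iff_add_eq_0 add.commute)
      qed (use c in auto)
      then show False using uminus_Omega_disjoint[of g n h] gh S by auto
    qed
    moreover have "g - h = 0\<^sub>v n \<longleftrightarrow> h = g"
    proof
      assume z: "g - h = 0\<^sub>v n"
      show "h = g"
      proof (rule eq_vecI)
        fix i assume "i < dim_vec g"
        moreover from this have "(g - h) $ i = 0" unfolding z using c by simp
        ultimately show "h $ i = g $ i" using c by simp
      qed (use c in auto)
    qed (use c in auto)
    ultimately show "(\<Sum>u\<in>carrier_vec n. 2 * (chi (u \<bullet> (g + h)) + chi (u \<bullet> (g - h))))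
      = (if h = g then 2 * 4 ^ n else 0)"
      using c by (simp add: sum_distrib_left[symmetric] sum.distrib sum_chi_carrier)
  qed
  also have "\<dots> = 2 * 4 ^ n * card S" using fin by simp
  finally show ?thesis .
qed

section \<open>Pairs congruent modulo 2 and the third moment\<close>

definition even_pairs :: "nat \<Rightarrow> 4 vec set \<Rightarrow> real" where
  "even_pairs n S = (\<Sum>g\<in>S. \<Sum>h\<in>S. if g + h \<in> even_vecs n then 1 else 0)"

lemma sum_colsum_square_even:
  assumes SV: "S \<subseteq> carrier_vec n"
  shows "(\<Sum>u\<in>even_vecs n. colsum S u ^ 2) = 4 * 2 ^ n * even_pairs n S"
proof -
  have "(\<Sum>u\<in>even_vecs n. colsum S u ^ 2)
    = (\<Sum>u\<in>even_vecs n. \<Sum>g\<in>S. \<Sum>h\<in>S. 2 * (chi (u \<bullet> (g + h)) + chi (u \<bullet> (g - h))))"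
    by (intro sum.cong refl colsum_square[OF SV] even_vecs_carrier)
  also have "\<dots> = (\<Sum>g\<in>S. \<Sum>h\<in>S. \<Sum>u\<in>even_vecs n. 2 * (chi (u \<bullet> (g + h)) + chi (u \<bullet> (g - h))))"
    by (subst sum.swap) (intro sum.cong refl sum.swap)
  also have "\<dots> = (\<Sum>g\<in>S. \<Sum>h\<in>S. 4 * 2 ^ n * (if g + h \<in> even_vecs n then 1 else 0))"
  proof (intro sum.cong refl)
    fix g h assume "g \<in> S" "h \<in> S"
    then have c: "g \<in> carrier_vec n" "h \<in> carrier_vec n" using SV by auto
    then show "(\<Sum>u\<in>even_vecs n. 2 * (chi (u \<bullet> (g + h)) + chi (u \<bullet> (g - h))))
      = 4 * 2 ^ n * (if g + h \<in> even_vecs n then 1 else 0)"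
      by (simp add: sum_distrib_left[symmetric] sum.distrib sum_chi_even even_vecs_diff_iff_add)
  qed
  finally show ?thesis by (simp add: even_pairs_def sum_distrib_left)
qed

text \<open>By orthogonality the third moment counts zero sums of \<open>g\<close>,
  \<open>h\<close>, \<open>l\<close> with signs. If \<open>g\<close> and \<open>h\<close> are
  congruent modulo 2, then \<open>g + h\<close> and \<open>g - h\<close> are even while
  \<open>l\<close> is not, so there are none; otherwise each of the four sign patterns admits at
  most one \<open>l\<close>.\<close>

lemma moment_3_le:
  assumes S: "S \<subseteq> Omega n"
  shows "moment n S 3 \<le> 8 * 4 ^ n * ((card S)\<^sup>2 - even_pairs n S)"
proof -
  have fin: "finite S" and SV: "S \<subseteq> carrier_vec n"
    using S finite_Omega finite_subset Omega_carrier by blast+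
  let ?z = "\<lambda>x. if x = 0\<^sub>v n then 1 else 0 :: real"
  let ?T = "\<lambda>g h l. ?z (g + h + l) + ?z (g + h - l) + ?z (g - h + l) + ?z (g - h - l)"
  have eqs: "a + l = 0\<^sub>v n \<longleftrightarrow> l = - a" "a - l = 0\<^sub>v n \<longleftrightarrow> l = a"
    if "a \<in> carrier_vec n" "l \<in> carrier_vec n" for a l :: "4 vec"
    using that by (auto simp: vec_eq_iff eq_neg_iff_add_eq_0 add.commute)
  have "moment n S 3 = (\<Sum>u\<in>carrier_vec n. \<Sum>g\<in>S. \<Sum>h\<in>S. \<Sum>l\<in>S. 2 * (chi (u \<bullet> (g + h + l))
      + chi (u \<bullet> (g + h - l)) + chi (u \<bullet> (g - h + l)) + chi (u \<bullet> (g - h - l))))"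
    unfolding moment_def by (intro sum.cong refl colsum_cube[OF SV])
  also have "\<dots> = (\<Sum>g\<in>S. \<Sum>h\<in>S. \<Sum>l\<in>S. \<Sum>u\<in>carrier_vec n. 2 * (chi (u \<bullet> (g + h + l))
      + chi (u \<bullet> (g + h - l)) + chi (u \<bullet> (g - h + l)) + chi (u \<bullet> (g - h - l))))"
    by (rule trans[OF sum.swap], rule sum.cong[OF refl], rule trans[OF sum.swap],
        rule sum.cong[OF refl], rule sum.swap)
  also have "\<dots> = (\<Sum>g\<in>S. \<Sum>h\<in>S. \<Sum>l\<in>S. 2 * 4 ^ n * ?T g h l)"
  proof (intro sum.cong refl)
    fix g h l assume "g \<in> S" "h \<in> S" "l \<in> S"
    then have c: "g \<in> carrier_vec n" "h \<in> carrier_vec n" "l \<in> carrier_vec n" using SV by auto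
    then show "(\<Sum>u\<in>carrier_vec n. 2 * (chi (u \<bullet> (g + h + l))
      + chi (u \<bullet> (g + h - l)) + chi (u \<bullet> (g - h + l)) + chi (u \<bullet> (g - h - l)))) = 2 * 4 ^ n * ?T g h l"
      by (simp only: sum_distrib_left[symmetric] sum.distrib)
        (simp add: sum_chi_carrier distrib_left)
  qed
  also have "\<dots> = 2 * 4 ^ n * (\<Sum>g\<in>S. \<Sum>h\<in>S. \<Sum>l\<in>S. ?T g h l)"
    by (simp only: sum_distrib_left)
  also have "(\<Sum>g\<in>S. \<Sum>h\<in>S. \<Sum>l\<in>S. ?T g h l)
    \<le> (\<Sum>g\<in>S. \<Sum>h\<in>S. 4 * (1 - (if g + h \<in> even_vecs n then 1 else 0)))"
  proof (intro sum_mono)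
    fix g h assume gh: "g \<in> S" "h \<in> S"
    then have c: "g \<in> carrier_vec n" "h \<in> carrier_vec n" using SV by auto
    show "(\<Sum>l\<in>S. ?T g h l) \<le> 4 * (1 - (if g + h \<in> even_vecs n then 1 else 0))"
    proof (cases "g + h \<in> even_vecs n")
      case True
      then have e: "g - h \<in> even_vecs n" using c by (simp add: even_vecs_diff_iff_add)
      have "?T g h l = 0" if "l \<in> S" for l
      proof -
        have l: "l \<in> carrier_vec n" "l \<notin> even_vecs n" using that S Omega_carrier Omega_not_even by blast+
        have "- a \<in> even_vecs n" if "a \<in> even_vecs n" for a using that by (auto simp: even_vecs_def)
        then have "l \<noteq> - (g + h)" "l \<noteq> g + h" "l \<noteq> - (g - h)" "l \<noteq> g - h"
          using l(2) e True by blast+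
        then show ?thesis using eqs[of "g + h" l] eqs[of "g - h" l] l(1) c by simp
      qed
      then show ?thesis using True by simp
    next
      case False
      have le1: "(\<Sum>l\<in>S. if l = a then 1 else 0 :: real) \<le> 1" for a using fin by simp
      have "(\<Sum>l\<in>S. ?T g h l) = (\<Sum>l\<in>S. (if l = - (g + h) then 1 else 0) + (if l = g + h then 1 else 0)
        + (if l = - (g - h) then 1 else 0) + (if l = g - h then 1 else 0))"
      proof (intro sum.cong refl)
        fix l assume "l \<in> S"
        then have l: "l \<in> carrier_vec n" using SV by auto
        show "?T g h l = (if l = - (g + h) then 1 else 0) + (if l = g + h then 1 else 0)
        + (if l = - (g - h) then 1 else 0) + (if l = g - h then 1 else 0)"
          using eqs[of "g + h" l] eqs[of "g - h" l] l c by simp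
      qed
      also have "\<dots> \<le> 4"
        unfolding sum.distrib
        using le1[of "- (g + h)"] le1[of "g + h"] le1[of "- (g - h)"] le1[of "g - h"] by linarith
      finally show ?thesis using False by simp
    qed
  qed
  also have "(\<Sum>g\<in>S. \<Sum>h\<in>S. 4 * (1 - (if g + h \<in> even_vecs n then 1 else 0)))
    = 4 * ((card S)\<^sup>2 - even_pairs n S)"
    by (simp only: sum_distrib_left[symmetric] sum_subtractf even_pairs_def) (simp add: power2_eq_square)
  finally show ?thesis by (simp add: right_diff_distrib)
qed

lemma even_pairs_bounds:
  assumes S: "S \<subseteq> Omega n"
  shows "even_pairs n S \<le> (card S)\<^sup>2" and "even_pairs n S = (card S)\<^sup>2 \<longleftrightarrow> even_set n S"
proof -
  have fin: "finite S" and SV: "S \<subseteq> carrier_vec n"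
    using S finite_Omega finite_subset Omega_carrier by blast+
  let ?f = "\<lambda>g h. 1 - (if g + h \<in> even_vecs n then 1 else 0 :: real)"
  have eq: "(card S)\<^sup>2 - even_pairs n S = (\<Sum>g\<in>S. \<Sum>h\<in>S. ?f g h)"
    by (simp only: sum_subtractf even_pairs_def) (simp add: power2_eq_square)
  have nn: "(\<Sum>h\<in>S. ?f g h) \<ge> 0" for g by (intro sum_nonneg) auto
  have "(\<Sum>g\<in>S. \<Sum>h\<in>S. ?f g h) \<ge> 0" by (intro sum_nonneg nn)
  then show "even_pairs n S \<le> (card S)\<^sup>2" using eq by linarith
  have "even_pairs n S = (card S)\<^sup>2 \<longleftrightarrow> (\<Sum>g\<in>S. \<Sum>h\<in>S. ?f g h) = 0" using eq by auto
  also have "\<dots> \<longleftrightarrow> (\<forall>g\<in>S. (\<Sum>h\<in>S. ?f g h) = 0)" using fin nn by (intro sum_nonneg_eq_0_iff) auto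
  also have "\<dots> \<longleftrightarrow> (\<forall>g\<in>S. \<forall>h\<in>S. ?f g h = 0)" using fin by (intro ball_cong refl sum_nonneg_eq_0_iff) auto
  also have "\<dots> \<longleftrightarrow> (\<forall>g\<in>S. \<forall>h\<in>S. g + h \<in> even_vecs n)" by auto
  also have "\<dots> \<longleftrightarrow> even_set n S" using S SV by (auto simp: even_set_def even_vecs_def subset_iff)
  finally show "even_pairs n S = (card S)\<^sup>2 \<longleftrightarrow> even_set n S" .
qed

text \<open>All elements are congruent modulo 2 and hence odd in the same coordinates. Their first
  odd coordinates coincide, and membership in \<open>Omega\<close> makes the entry there 1.\<close>

lemma even_set_common_one:
  assumes E: "even_set n S" and ne: "S \<noteq> {}"
  obtains i where "i < n" "\<And>g. g \<in> S \<Longrightarrow> g $ i = 1"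
proof -
  obtain g0 where g0: "g0 \<in> S" using ne by auto
  have SO: "S \<subseteq> Omega n" using E by (simp add: even_set_def)
  obtain i where i: "i < n" "g0 $ i = 1" "\<And>j. j < i \<Longrightarrow> even_Z4 (g0 $ j)"
    using g0 SO by (auto simp: Omega_def)
  have "g $ i = 1" if g: "g \<in> S" for g
  proof -
    have c: "g \<in> carrier_vec n" "g0 \<in> carrier_vec n" using g g0 SO Omega_carrier by auto
    have eq: "even_Z4 (g $ j) \<longleftrightarrow> even_Z4 (g0 $ j)" if "j < n" for j
    proof -
      have "even_Z4 ((g + g0) $ j)" using E g g0 that unfolding even_set_def by blast
      then show ?thesis using c that by (simp add: even_Z4_add_iff)
    qed
    obtain l where l: "l < n" "g $ l = 1" "\<And>j. j < l \<Longrightarrow> even_Z4 (g $ j)"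
      using g SO by (auto simp: Omega_def)
    have odd1: "\<not> even_Z4 1" by (simp add: even_Z4_def)
    have "\<not> i < l" using l(3)[of i] eq[OF i(1)] i(2) odd1 by auto
    moreover have "\<not> l < i" using i(3)[of l] eq[OF l(1)] l(2) odd1 by auto
    ultimately show ?thesis using l(2) by (simp add: not_less)
  qed
  then show ?thesis using that i(1) by blast
qed

lemma even_set_diff:
  assumes "even_set n S" "g \<in> S" "h \<in> S"
  shows "g - h \<in> even_vecs n" "g \<in> carrier_vec n" "h \<in> carrier_vec n"
proof -
  show c: "g \<in> carrier_vec n" "h \<in> carrier_vec n"
    using assms Omega_carrier unfolding even_set_def by blast+
  show "g - h \<in> even_vecs n"
  proof -
    have "\<forall>i<n. even_Z4 ((g + h) $ i)" using assms unfolding even_set_def by blast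
    then show ?thesis using c by (simp add: even_vecs_diff_iff_add) (simp add: even_vecs_def)
  qed
qed

lemma colsum_even_set:
  assumes E: "even_set n S" and g0: "g0 \<in> S" and u: "u \<in> carrier_vec n"
  shows "colsum S u = 2 * chi (u \<bullet> g0) * (\<Sum>g\<in>S. chi (u \<bullet> (g - g0)))"
proof -
  have "chi (u \<bullet> g) = chi (u \<bullet> g0) * chi (u \<bullet> (g - g0))" if g: "g \<in> S" for g
  proof -
    note d = even_set_diff[OF E g g0]
    have "u \<bullet> g = u \<bullet> g0 + u \<bullet> (g - g0)"
      using d u by (simp add: scalar_prod_minus_distrib[of _ n])
    then show ?thesis using chi_add_even[OF scalar_prod_even[OF u d(1)], of "u \<bullet> g0"] by simp
  qed
  then show ?thesis by (simp add: colsum_def sum_distrib_left mult.assoc)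
qed

text \<open>Changing \<open>u\<close> by \<open>a\<close> in the common coordinate \<open>i\<close>
  adds \<open>a\<close> to \<open>u \<bullet> g0\<close> but leaves the products with the
  differences \<open>g - g0\<close> alone, since these vanish at \<open>i\<close>. The shift by 2
  kills odd moments; the shift by 1 exchanges even and odd values of \<open>u \<bullet> g0\<close>,
  so that exactly half of the full sum survives in an even moment.\<close>

lemma moment_even_set:
  assumes E: "even_set n S" and g0: "g0 \<in> S" and k: "k > 0"
  shows "moment n S k = (if even k
    then 2 ^ k / 2 * (\<Sum>u\<in>carrier_vec n. (\<Sum>g\<in>S. chi (u \<bullet> (g - g0))) ^ k) else 0)"
proof -
  obtain i where i: "i < n" "\<And>g. g \<in> S \<Longrightarrow> g $ i = 1"
    using even_set_common_one[OF E] g0 by blast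
  let ?V = "carrier_vec n :: 4 vec set"
  define R where "R u = (\<Sum>g\<in>S. chi (u \<bullet> (g - g0)))" for u
  define w where "w a = a \<cdot>\<^sub>v unit_vec n i" for a :: 4
  have wV: "w a \<in> ?V" for a by (simp add: w_def)
  have Rw: "R (u + w a) = R u" if u: "u \<in> ?V" for u a
  proof -
    have "(u + w a) \<bullet> (g - g0) = u \<bullet> (g - g0)" if "g \<in> S" for g
    proof -
      note d = even_set_diff[OF E that g0]
      have "w a \<bullet> (g - g0) = 0"
        unfolding w_def using d i that g0 by (subst unit_smult_scalar_prod[of _ n]) auto
      then show ?thesis using add_scalar_prod_distrib[OF u wV, of "g - g0" a] d by simp
    qed
    then show ?thesis by (simp add: R_def)
  qed
  have g0w: "(u + w a) \<bullet> g0 = u \<bullet> g0 + a" if u: "u \<in> ?V" for u a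
  proof -
    note d = even_set_diff[OF E g0 g0]
    have "w a \<bullet> g0 = a"
      unfolding w_def using d i g0 by (subst unit_smult_scalar_prod[of _ n]) auto
    then show ?thesis using add_scalar_prod_distrib[OF u wV, of g0 a] d by simp
  qed
  have shift: "(\<Sum>u\<in>?V. chi (u \<bullet> g0 + a) ^ k * R u ^ k) = (\<Sum>u\<in>?V. chi (u \<bullet> g0) ^ k * R u ^ k)" for a
    using sum_shift_vec(3)[of ?V n "w a" "\<lambda>u. chi (u \<bullet> g0) ^ k * R u ^ k"] wV[of a]
    by (simp add: Rw g0w)
  have m: "moment n S k = 2 ^ k * (\<Sum>u\<in>?V. chi (u \<bullet> g0) ^ k * R u ^ k)"
    unfolding moment_def sum_distrib_left
    by (intro sum.cong refl) (simp add: colsum_even_set[OF E g0] R_def power_mult_distrib)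
  show ?thesis
  proof (cases "even k")
    case False
    then show ?thesis using shift[of 2] m by (simp add: chi_add_2 sum_negf)
  next
    case True
    \<comment> \<open>For even positive \<open>k\<close>, exactly one of the two powers of
      \<open>chi\<close> is 1 and the other is 0.\<close>
    have "(\<Sum>u\<in>?V. R u ^ k) = (\<Sum>u\<in>?V. chi (u \<bullet> g0) ^ k * R u ^ k + chi (u \<bullet> g0 + 1) ^ k * R u ^ k)"
    proof (intro sum.cong refl)
      fix u
      have "\<not> even_Z4 1" by (simp add: even_Z4_def)
      then show "R u ^ k = chi (u \<bullet> g0) ^ k * R u ^ k + chi (u \<bullet> g0 + 1) ^ k * R u ^ k"
        using True k by (simp add: chi_even_power even_Z4_add_iff)
    qed
    then have "(\<Sum>u\<in>?V. R u ^ k) = 2 * (\<Sum>u\<in>?V. chi (u \<bullet> g0) ^ k * R u ^ k)"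
      using shift[of 1] by (simp add: sum.distrib)
    then show ?thesis using True m by (simp add: R_def)
  qed
qed

text \<open>At an even \<open>u\<close> all differences \<open>g - g0\<close> have character value
  1, so the column sum is \<open>2 * card S\<close> up to sign. Both signs occur equally often
  because the character of \<open>g0\<close> sums to zero over the even vectors.\<close>

lemma sum_even_vecs_even_set:
  fixes F :: "real \<Rightarrow> real"
  assumes E: "even_set n S" and ne: "S \<noteq> {}"
  shows "(\<Sum>u\<in>even_vecs n. F (colsum S u)) = 2 ^ n * ((F (2 * real (card S)) + F (- 2 * real (card S))) / 2)"
proof -
  obtain g0 where g0: "g0 \<in> S" using ne by auto
  have g0c: "g0 \<in> carrier_vec n" "g0 \<notin> even_vecs n"
    using E g0 Omega_carrier Omega_not_even unfolding even_set_def by blast+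
  let ?t = "real (card S)"
  \<comment> \<open>Linear interpolation of \<open>F\<close> in the sign
    \<open>chi (u \<bullet> g0)\<close>, which makes orthogonality applicable for arbitrary
    \<open>F\<close>.\<close>
  have "F (colsum S u) = (F (2 * ?t) + F (- 2 * ?t)) / 2 + chi (u \<bullet> g0) * ((F (2 * ?t) - F (- 2 * ?t)) / 2)"
    if u: "u \<in> even_vecs n" for u
  proof -
    have "(\<Sum>g\<in>S. chi (u \<bullet> (g - g0))) = ?t"
      using even_set_diff[OF E _ g0] u by (simp add: scalar_prod_even_even)
    then have c: "colsum S u = 2 * chi (u \<bullet> g0) * ?t"
      using colsum_even_set[OF E g0 even_vecs_carrier[OF u]] by simp
    have "even_Z4 (u \<bullet> g0)"
      using scalar_prod_even[OF g0c(1) u] comm_scalar_prod[OF g0c(1) even_vecs_carrier[OF u]] by simp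
    then consider "chi (u \<bullet> g0) = 1" | "chi (u \<bullet> g0) = -1" by (auto simp: even_Z4_def chi_def)
    then show ?thesis using c by cases (simp_all add: field_simps)
  qed
  then have "(\<Sum>u\<in>even_vecs n. F (colsum S u)) = (\<Sum>u\<in>even_vecs n.
    (F (2 * ?t) + F (- 2 * ?t)) / 2 + chi (u \<bullet> g0) * ((F (2 * ?t) - F (- 2 * ?t)) / 2))"
    by (rule sum.cong[OF refl])
  then show ?thesis
    using g0c by (simp only: sum.distrib sum_distrib_right[symmetric] sum_chi_even) (simp add: card_even_vecs)
qed

text \<open>The column sums of \<open>S\<close> and of its complement add up to that of
  \<open>Omega\<close>, which is \<open>- (2 ^ n)\<close> at nonzero even vectors and zero at
  vectors that are not even. Only the zero run needs a separate correction.\<close>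

lemma moment_complement:
  assumes S: "S \<subseteq> Omega n"
  shows "moment n (Omega n - S) k
    = (2 * real (card (Omega n - S))) ^ k - (-1) ^ k * (2 * real (card S) + 2 ^ n) ^ k
      + (-1) ^ k * (moment n S k + (\<Sum>u\<in>even_vecs n. (colsum S u + 2 ^ n) ^ k - colsum S u ^ k))"
proof -
  \<comment> \<open>The contribution of the zero run minus the value that the formula for the
    nonzero even runs would assign to it.\<close>
  let ?c = "(2 * real (card (Omega n - S))) ^ k - (-1) ^ k * (2 * real (card S) + 2 ^ n) ^ k"
  let ?e = "\<lambda>u. (colsum S u + 2 ^ n) ^ k - colsum S u ^ k"
  have "colsum (Omega n - S) u ^ k = (if u = 0\<^sub>v n then ?c else 0)
      + (-1) ^ k * (colsum S u ^ k + (if u \<in> even_vecs n then ?e u else 0))"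
    if u: "u \<in> carrier_vec n" for u
  proof (cases "u = 0\<^sub>v n")
    case True
    then show ?thesis
      using colsum_zero[of "Omega n - S" n] colsum_zero[OF S] even_vecs_zero[of n] by simp
  next
    case False
    have "colsum (Omega n - S) u = colsum (Omega n) u - colsum S u"
      unfolding colsum_def using S by (intro sum_diff) auto
    also have "\<dots> = - (colsum S u + (if u \<in> even_vecs n then 2 ^ n else 0))"
      using False colsum_Omega[OF u] by simp
    finally have "colsum (Omega n - S) u ^ k = (-1) ^ k * (colsum S u + (if u \<in> even_vecs n then 2 ^ n else 0)) ^ k"
      by (simp only: power_minus[of "colsum S u + _"])
    then show ?thesis using False by simp
  qed
  then have "moment n (Omega n - S) k = (\<Sum>u\<in>carrier_vec n. (if u = 0\<^sub>v n then ?c else 0)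
      + (-1) ^ k * (colsum S u ^ k + (if u \<in> even_vecs n then ?e u else 0)))"
    unfolding moment_def by (rule sum.cong[OF refl])
  also have "\<dots> = ?c + (-1) ^ k * (moment n S k
      + (\<Sum>u\<in>carrier_vec n. if u \<in> even_vecs n then ?e u else 0))"
    by (simp only: sum.distrib sum_distrib_left[symmetric] moment_def) simp
  also have "(\<Sum>u\<in>carrier_vec n. if u \<in> even_vecs n then ?e u else 0) = (\<Sum>u\<in>even_vecs n. ?e u)"
    by (rule sum.mono_neutral_cong_right) (auto simp: even_vecs_carrier)
  finally show ?thesis by simp
qed

text \<open>In the complement formula every term besides the moment of the set itself depends only
  on the size of the set, by the evaluation of column sums at even vectors.\<close>

lemma moment_complement_even_set:
  assumes "even_set n S" "even_set n T" "card S = card T" "card S > 0"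
  shows "moment n (Omega n - S) k - (-1) ^ k * moment n S k = moment n (Omega n - T) k - (-1) ^ k * moment n T k"
proof -
  have sub: "S \<subseteq> Omega n" "T \<subseteq> Omega n" using assms by (auto simp: even_set_def)
  have "card (Omega n - S) = card (Omega n - T)"
    using sub assms(3) by (simp add: card_Diff_subset finite_subset)
  moreover have "S \<noteq> {}" "T \<noteq> {}" using assms(3,4) by auto
  ultimately show ?thesis
    using assms sub by (simp add: moment_complement sum_even_vecs_even_set[where F = "\<lambda>x. (x + 2 ^ n) ^ k - x ^ k"] distrib_left)
qed

lemma moment_3_complement:
  assumes S: "S \<subseteq> Omega n"
  shows "moment n (Omega n - S) 3 = (2 * real (card (Omega n - S))) ^ 3 + (2 * real (card S) + 2 ^ n) ^ 3 - (2 ^ n) ^ 4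
    - moment n S 3 - 12 * 4 ^ n * even_pairs n S"
proof -
  have SV: "S \<subseteq> carrier_vec n" using S Omega_carrier by blast
  have "(\<Sum>u\<in>even_vecs n. (colsum S u + 2 ^ n) ^ 3 - colsum S u ^ 3)
    = (\<Sum>u\<in>even_vecs n. 3 * 2 ^ n * colsum S u ^ 2 + 3 * (2 ^ n) ^ 2 * colsum S u + (2 ^ n) ^ 3)"
    by (intro sum.cong refl) (simp add: power3_eq_cube power2_eq_square algebra_simps)
  \<comment> \<open>The linear term sums to zero, the quadratic term counts congruent pairs, and the
    constant \<open>(2 ^ n) ^ 3\<close> is taken once for each of the \<open>2 ^ n\<close> even
    vectors.\<close>
  also have "\<dots> = 3 * 2 ^ n * (4 * 2 ^ n * even_pairs n S) + (2 ^ n) ^ 4"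
    unfolding sum.distrib sum_distrib_left[symmetric] sum_colsum_square_even[OF SV] sum_colsum_even[OF S]
    by (simp add: card_even_vecs eval_nat_numeral)
  also have "3 * 2 ^ n * (4 * 2 ^ n * even_pairs n S) = 12 * 4 ^ n * even_pairs n S"
    using power_mult_distrib[of "2 :: real" 2 n] by simp
  finally show ?thesis using moment_complement[OF S, of 3] by simp
qed

text \<open>Relative to an even set, each ordered pair in \<open>T\<close> that is not congruent
  modulo 2 raises the third moment of the complement by \<open>12 * 4 ^ n\<close>, while zero-sum
  triples lower it by at most \<open>8 * 4 ^ n\<close> per such pair. The net increase is positive
  unless \<open>T\<close> is even.\<close>

lemma moment_3_complement_min:
  assumes S: "even_set n S" and T: "T \<subseteq> Omega n" and card: "card S = card T" "card S > 0"
  shows "moment n (Omega n - S) 3 \<le> moment n (Omega n - T) 3"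
    and "moment n (Omega n - T) 3 = moment n (Omega n - S) 3 \<Longrightarrow> even_set n T"
proof -
  have SO: "S \<subseteq> Omega n" using S by (simp add: even_set_def)
  obtain g0 where "g0 \<in> S" using card by fastforce
  then have m3: "moment n S 3 = 0" using moment_even_set[OF S, of g0 3] by simp
  have cards: "card (Omega n - S) = card (Omega n - T)"
    using SO T card(1) by (simp add: card_Diff_subset finite_subset)
  define p where "p = even_pairs n T"
  define t where "t = real (card T)"
  have pS: "even_pairs n S = t\<^sup>2" using even_pairs_bounds(2)[OF SO] S card by (simp add: t_def)
  have pT: "p \<le> t\<^sup>2" "p = t\<^sup>2 \<longleftrightarrow> even_set n T" using even_pairs_bounds[OF T] by (simp_all add: p_def t_def)
  have "moment n (Omega n - T) 3 - moment n (Omega n - S) 3 = 12 * 4 ^ n * (t\<^sup>2 - p) - moment n T 3"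
    using moment_3_complement[OF SO] moment_3_complement[OF T] m3 cards card pS
    by (simp add: algebra_simps p_def)
  moreover have "moment n T 3 \<le> 8 * 4 ^ n * (t\<^sup>2 - p)"
    using moment_3_le[OF T] by (simp add: p_def t_def)
  ultimately have ge: "moment n (Omega n - T) 3 - moment n (Omega n - S) 3 \<ge> 4 * 4 ^ n * (t\<^sup>2 - p)"
    by linarith
  have nn: "4 * 4 ^ n * (t\<^sup>2 - p) \<ge> 0" using pT(1) by simp
  show "moment n (Omega n - S) 3 \<le> moment n (Omega n - T) 3" using ge nn by linarith
  assume "moment n (Omega n - T) 3 = moment n (Omega n - S) 3"
  then have "4 * 4 ^ n * (t\<^sup>2 - p) = 0" using ge nn by linarith
  then show "even_set n T" using pT(2) by simp
qed

section \<open>Regular designs and even sets\<close>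

definition binary_vecs :: "nat \<Rightarrow> nat vec set" where
  "binary_vecs m = {x \<in> carrier_vec m. \<forall>i<m. x $ i \<in> {0, 1}}"

lemma binary_vecs_eq: "{x \<in> carrier_vec m. set\<^sub>v x \<subseteq> {0, 1}} = binary_vecs m"
  by (auto simp: binary_vecs_def vec_set_def image_subset_iff)

lemma card_binary_vecs: "card (binary_vecs m) = 2 ^ m"
  and finite_binary_vecs [simp]: "finite (binary_vecs m)"
  using card_vecs_over[of "{0, 1 :: nat}" m] by (simp_all add: binary_vecs_def numeral_2_eq_2)

definition rowsum :: "nat mat \<Rightarrow> nat vec \<Rightarrow> real" where
  "rowsum B x = (\<Sum>j<dim_col B. (-1) ^ (x \<bullet> col B j))"

text \<open>Runs of a regular design have natural numbers as entries, so the group operation modulo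
  2 is defined separately.\<close>

definition xor_vec :: "nat vec \<Rightarrow> nat vec \<Rightarrow> nat vec" where
  "xor_vec x y = vec (dim_vec x) (\<lambda>i. (x $ i + y $ i) mod 2)"

lemma xor_vec_binary: "\<lbrakk>x \<in> binary_vecs m; y \<in> binary_vecs m\<rbrakk> \<Longrightarrow> xor_vec x y \<in> binary_vecs m"
  by (auto simp: xor_vec_def binary_vecs_def)

lemma xor_vec_cancel: "\<lbrakk>x \<in> binary_vecs m; y \<in> binary_vecs m\<rbrakk> \<Longrightarrow> xor_vec (xor_vec x y) y = x"
proof (rule eq_vecI)
  fix i assume "x \<in> binary_vecs m" "y \<in> binary_vecs m" "i < dim_vec x"
  then have "i < m" "x $ i = 0 \<or> x $ i = 1" "y $ i = 0 \<or> y $ i = 1" "dim_vec x = m"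
    by (auto simp: binary_vecs_def)
  then show "xor_vec (xor_vec x y) y $ i = x $ i" by (auto simp: xor_vec_def)
qed (simp add: xor_vec_def)

lemma neg_one_power_scalar_prod:
  "(-1 :: real) ^ (x \<bullet> b) = (\<Prod>i<dim_vec b. (-1) ^ (x $ i * b $ i))"
  by (simp add: scalar_prod_def power_sum atLeast0LessThan)

lemma neg_one_power_xor_vec:
  assumes "x \<in> binary_vecs m" "y \<in> binary_vecs m" "b \<in> carrier_vec m"
  shows "(-1 :: real) ^ (xor_vec x y \<bullet> b) = (-1) ^ (x \<bullet> b) * (-1) ^ (y \<bullet> b)"
proof -
  have "(-1 :: real) ^ ((p + q) mod 2 * c) = (-1) ^ (p * c) * (-1) ^ (q * c)" for p q c :: nat
    by (simp add: power_mult minus_one_power_iff mod2_eq_if)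
  then show ?thesis
    unfolding neg_one_power_scalar_prod prod.distrib[symmetric] using assms
    by (intro prod.cong refl) (auto simp: xor_vec_def binary_vecs_def)
qed

lemma wordlength_regular:
  assumes B: "B \<in> carrier_mat m k"
  shows "wordlength (regular_design B) r = (\<Sum>x\<in>binary_vecs m. poly (kraw k r) (rowsum B x)) / 2 ^ m"
proof -
  let ?D = "regular_design B"
  have D: "runs ?D = binary_vecs m" "factors ?D = {..<k}" "\<And>x j. entry ?D x j = (-1) ^ (x \<bullet> col B j)"
    using B binary_vecs_eq[of m] by (simp_all add: regular_design_def)
  have "wordlength ?D r = (\<Sum>x\<in>runs ?D. poly (kraw (card (factors ?D)) r) (rowsum B x)) / card (runs ?D)"
  proof (rule wordlength_kraw[where dif = xor_vec])
    show "bij_betw (\<lambda>x. xor_vec x y) (runs ?D) (runs ?D)" if "y \<in> runs ?D" for y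
      using that xor_vec_binary xor_vec_cancel unfolding D
      by (intro bij_betw_byWitness[where f' = "\<lambda>x. xor_vec x y"]) auto
    fix x y assume "x \<in> runs ?D" "y \<in> runs ?D"
    then show "(\<Sum>j\<in>factors ?D. entry ?D x j * entry ?D y j) = rowsum B (xor_vec x y)"
      unfolding D rowsum_def using B
      by (intro sum.cong) (auto simp: neg_one_power_xor_vec[of _ m])
  qed (auto simp: D power_mult[symmetric] mult.commute)
  then show ?thesis by (simp add: D card_binary_vecs)
qed

definition binary_moment :: "nat mat \<Rightarrow> nat \<Rightarrow> real" where
  "binary_moment B p = (\<Sum>x\<in>binary_vecs (dim_row B). (rowsum B x + 1) ^ p)"

text \<open>Adding 1 to the row sum corresponds to adjoining a column of ones to the design.\<close>

lemma wordlength_regular_pair: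
  assumes B: "B \<in> carrier_mat m k" and r: "r \<ge> 1"
  shows "wordlength (regular_design B) (2 * r - 1) + wordlength (regular_design B) (2 * r)
    = (\<Sum>x\<in>binary_vecs m. poly (kraw (real k + 1) (2 * r)) (rowsum B x + 1)) / 2 ^ m"
proof -
  obtain q where q: "2 * r = Suc q" using r by (cases "2 * r") auto
  have "2 * r - 1 = q" using q by simp
  then show ?thesis
    unfolding q wordlength_regular[OF B] poly_kraw_plus_one
    by (simp add: sum.distrib add_divide_distrib)
qed

section \<open>Reduction of quaternary runs to binary runs\<close>

lemma chi_mult_double: "chi (a * (2 * of_nat b)) = (-1) ^ ((if even_Z4 a then 0 else 1) * b)"
proof (induction b)
  case (Suc b)
  have "a * (2 * of_nat (Suc b)) = a * (2 * of_nat b) + a * 2" by (simp add: distrib_left)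
  moreover have "even_Z4 (a * 2)" using even_Z4_mult[of 2 a] by (simp add: mult.commute)
  moreover have "chi (a * 2) = (if even_Z4 a then 1 else -1)"
    by (cases a rule: Z4_cases) (simp_all add: chi_def even_Z4_def)
  ultimately show ?case using Suc by (simp add: chi_add_even)
qed simp

lemma chi_sum_even:
  assumes "finite I" "\<And>i. i \<in> I \<Longrightarrow> even_Z4 (f i)"
  shows "chi (sum f I) = (\<Prod>i\<in>I. chi (f i))"
  using assms
proof (induction I)
  case (insert i I)
  then have "even_Z4 (sum f I)" by (intro even_Z4_sum) auto
  then show ?case using insert by (simp add: chi_add_even)
qed simp

text \<open>The increasing enumeration of all indices other than \<open>i\<close>, used to delete
  coordinate \<open>i\<close>. An arbitrary \<open>i\<close> is allowed because the common entry 1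
  of an even set may stand in any coordinate.\<close>

definition skip :: "nat \<Rightarrow> nat \<Rightarrow> nat" where
  "skip i l = (if l < i then l else Suc l)"

lemma skip_less: "l < m \<Longrightarrow> skip i l < Suc m"
  by (simp add: skip_def)

lemma insert_skip_image: "i < Suc m \<Longrightarrow> {..<Suc m} = insert i (skip i ` {..<m})"
proof (intro equalityI subsetI)
  fix a assume i: "i < Suc m" and a: "a \<in> {..<Suc m}"
  have "a \<in> skip i ` {..<m}" if "a \<noteq> i"
    by (rule image_eqI[where x = "if a < i then a else a - 1"]) (use that i a in \<open>auto simp: skip_def\<close>)
  then show "a \<in> insert i (skip i ` {..<m})" by blast
qed (auto simp: skip_def split: if_splits)

lemma skip_neq: "skip i l \<noteq> i"
  by (simp add: skip_def)

lemma inj_skip: "inj_on (skip i) I"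
  by (auto simp: inj_on_def skip_def split: if_splits)

definition parity_vec :: "nat \<Rightarrow> nat \<Rightarrow> 4 vec \<Rightarrow> nat vec" where
  "parity_vec m i u = vec m (\<lambda>l. if even_Z4 (u $ skip i l) then 0 else 1)"

lemma parity_vec_eq_iff:
  assumes "x \<in> binary_vecs m"
  shows "parity_vec m i u = x \<longleftrightarrow> (\<forall>l<m. even_Z4 (u $ skip i l) \<longleftrightarrow> x $ l = 0)"
proof -
  have x: "dim_vec x = m" "\<And>l. l < m \<Longrightarrow> x $ l = 0 \<or> x $ l = 1"
    using assms by (auto simp: binary_vecs_def)
  have "parity_vec m i u = x \<longleftrightarrow> (\<forall>l<m. parity_vec m i u $ l = x $ l)"
    using x(1) by (simp add: vec_eq_iff parity_vec_def)
  also have "\<dots> \<longleftrightarrow> (\<forall>l<m. even_Z4 (u $ skip i l) \<longleftrightarrow> x $ l = 0)"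
  proof (intro all_cong)
    fix l assume "l < m"
    then show "parity_vec m i u $ l = x $ l \<longleftrightarrow> (even_Z4 (u $ skip i l) \<longleftrightarrow> x $ l = 0)"
      using x(2)[of l] by (auto simp: parity_vec_def)
  qed
  finally show ?thesis .
qed

text \<open>Reduction modulo 2 with coordinate \<open>i\<close> deleted is additive and onto, so its
  fibres are translates of one another and have equal size.\<close>

lemma sum_parity_vec:
  fixes F :: "nat vec \<Rightarrow> real"
  assumes i: "i < Suc m"
  shows "(\<Sum>u\<in>carrier_vec (Suc m). F (parity_vec m i u)) = 4 ^ Suc m / 2 ^ m * (\<Sum>x\<in>binary_vecs m. F x)"
proof -
  let ?V = "carrier_vec (Suc m) :: 4 vec set"
  let ?fib = "\<lambda>x. {u \<in> ?V. parity_vec m i u = x}"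
  have zero: "0\<^sub>v m \<in> binary_vecs m" by (simp add: binary_vecs_def)
  have card: "card (?fib x) = card (?fib (0\<^sub>v m))" if x: "x \<in> binary_vecs m" for x
  proof -
    \<comment> \<open>A lift of \<open>x\<close>; the entry at \<open>a = i\<close> is an arbitrary
      filler, since \<open>skip i\<close> never takes the value \<open>i\<close>.\<close>
    define w :: "4 vec" where "w = vec (Suc m) (\<lambda>a. of_nat (x $ (if a < i then a else a - 1)))"
    have w: "w \<in> ?V" by (simp add: w_def)
    have par: "even_Z4 (w $ skip i l) \<longleftrightarrow> x $ l = 0" if l: "l < m" for l
    proof -
      have "w $ skip i l = of_nat (x $ l)" using skip_less[OF l, of i] by (auto simp: w_def skip_def)
      moreover have "x $ l = 0 \<or> x $ l = 1" using x l by (auto simp: binary_vecs_def)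
      ultimately show ?thesis by (auto simp: even_Z4_def)
    qed
    have idx: "(u + w) $ skip i l = u $ skip i l + w $ skip i l"
      "(u - w) $ skip i l = u $ skip i l - w $ skip i l" if "l < m" for u l
      using w skip_less[OF that, of i] by simp_all
    have "bij_betw (\<lambda>u. u + w) (?fib (0\<^sub>v m)) (?fib x)"
    proof (rule bij_betw_byWitness[where f' = "\<lambda>u. u - w"])
      show "\<forall>u\<in>?fib (0\<^sub>v m). u + w - w = u" "\<forall>u\<in>?fib x. u - w + w = u"
        using w by (auto intro!: eq_vecI)
      show "(\<lambda>u. u + w) ` ?fib (0\<^sub>v m) \<subseteq> ?fib x"
        using w par x by (auto simp: parity_vec_eq_iff[OF zero] parity_vec_eq_iff[OF x] idx even_Z4_add_iff)
      show "(\<lambda>u. u - w) ` ?fib x \<subseteq> ?fib (0\<^sub>v m)"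
        using w par x by (auto simp: parity_vec_eq_iff[OF zero] parity_vec_eq_iff[OF x] idx even_Z4_diff_iff)
    qed
    then show ?thesis by (rule bij_betw_same_card[symmetric])
  qed
  have group: "(\<Sum>u\<in>?V. G (parity_vec m i u)) = real (card (?fib (0\<^sub>v m))) * (\<Sum>x\<in>binary_vecs m. G x)"
    for G :: "nat vec \<Rightarrow> real"
  proof -
    have "parity_vec m i ` ?V \<subseteq> binary_vecs m" by (auto simp: parity_vec_def binary_vecs_def split: if_split_asm)
    then have "(\<Sum>u\<in>?V. G (parity_vec m i u)) = (\<Sum>x\<in>binary_vecs m. \<Sum>u\<in>?fib x. G (parity_vec m i u))"
      by (intro sum.group[symmetric]) auto
    also have "\<dots> = (\<Sum>x\<in>binary_vecs m. real (card (?fib (0\<^sub>v m))) * G x)"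
      by (intro sum.cong refl) (simp add: card[symmetric])
    finally show ?thesis by (simp add: sum_distrib_left)
  qed
  \<comment> \<open>The common fibre size comes from counting all vectors, that is, from summing the
    constant 1.\<close>
  have "real (card (?fib (0\<^sub>v m))) = 4 ^ Suc m / 2 ^ m"
    using group[of "\<lambda>_. 1"] by (simp add: card_carrier_vec_Z4 card_binary_vecs field_simps)
  then show ?thesis using group[of F] by simp
qed

text \<open>The columns of \<open>B\<close> are the halved differences from \<open>g0\<close> with
  coordinate \<open>i\<close> deleted. Their characters at \<open>u\<close> are the entries of the
  regular design at the parity vector of \<open>u\<close>, and \<open>g0\<close> itself contributes
  the added 1. This covers both \<open>Gbar\<close> and arbitrary even sets.\<close>

lemma moment_eq_binary_moment:
  assumes E: "even_set (Suc m) S" and g0: "g0 \<in> S"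
    and i: "i < Suc m" "\<And>g. g \<in> S \<Longrightarrow> g $ i = 1"
    and B: "B \<in> carrier_mat m k" and f: "bij_betw f {..<k} (S - {g0})"
    and Bf: "\<And>l j. \<lbrakk>l < m; j < k\<rbrakk> \<Longrightarrow> f j $ skip i l - g0 $ skip i l = 2 * of_nat (B $$ (l, j))"
    and p: "even p" "p > 0"
  shows "moment (Suc m) S p = 2 ^ p / 2 * (4 ^ Suc m / 2 ^ m) * binary_moment B p"
proof -
  let ?R = "\<lambda>u. \<Sum>g\<in>S. chi (u \<bullet> (g - g0))"
  have fin: "finite S" using E finite_Omega finite_subset unfolding even_set_def by blast
  have R: "?R u = rowsum B (parity_vec m i u) + 1" if u: "u \<in> carrier_vec (Suc m)" for u
  proof -
    have chi_f: "chi (u \<bullet> (f j - g0)) = (-1) ^ (parity_vec m i u \<bullet> col B j)" if j: "j < k" for j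
    proof -
      have fS: "f j \<in> S" using f j by (auto simp: bij_betw_def)
      note d = even_set_diff[OF E fS g0]
      let ?h = "f j - g0"
      have h: "?h $ a = f j $ a - g0 $ a" if "a < Suc m" for a using d that by simp
      have "u \<bullet> ?h = (\<Sum>a<Suc m. u $ a * ?h $ a)"
        using carrier_vecD[OF even_vecs_carrier[OF d(1)]] by (simp only: scalar_prod_def atLeast0LessThan)
      also have "\<dots> = u $ i * ?h $ i + (\<Sum>l<m. u $ skip i l * ?h $ skip i l)"
        unfolding insert_skip_image[OF i(1)]
        by (subst sum.insert) (auto simp: sum.reindex[OF inj_skip] skip_neq[symmetric])
      \<comment> \<open>Coordinate \<open>i\<close> drops out because \<open>f j\<close> and
        \<open>g0\<close> both have entry 1 there.\<close>
      also have "\<dots> = (\<Sum>l<m. u $ skip i l * (2 * of_nat (B $$ (l, j))))"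
        using i fS g0 h j by (simp add: skip_less Bf)
      finally have "chi (u \<bullet> ?h) = (\<Prod>l<m. chi (u $ skip i l * (2 * of_nat (B $$ (l, j)))))"
        by (simp add: chi_sum_even even_Z4_mult even_dbl mult.commute[of "u $ _"])
      also have "\<dots> = (-1) ^ (parity_vec m i u \<bullet> col B j)"
        unfolding neg_one_power_scalar_prod chi_mult_double using B j
        by (intro prod.cong) (auto simp: parity_vec_def)
      finally show ?thesis .
    qed
    have "u \<bullet> (g0 - g0) = 0" using even_set_diff[OF E g0 g0] u by simp
    then have "?R u = 1 + (\<Sum>g\<in>S - {g0}. chi (u \<bullet> (g - g0)))"
      using sum.remove[OF fin g0, of "\<lambda>g. chi (u \<bullet> (g - g0))"] by simp
    also have "(\<Sum>g\<in>S - {g0}. chi (u \<bullet> (g - g0))) = (\<Sum>j<k. chi (u \<bullet> (f j - g0)))"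
      using sum.reindex_bij_betw[OF f, of "\<lambda>g. chi (u \<bullet> (g - g0))"] by simp
    also have "\<dots> = rowsum B (parity_vec m i u)" using B chi_f by (simp add: rowsum_def)
    finally show ?thesis by simp
  qed
  have "moment (Suc m) S p = 2 ^ p / 2 * (\<Sum>u\<in>carrier_vec (Suc m). (rowsum B (parity_vec m i u) + 1) ^ p)"
    using moment_even_set[OF E g0 p(2)] p(1) R by simp
  then show ?thesis
    using sum_parity_vec[OF i(1), of "\<lambda>x. (rowsum B x + 1) ^ p"] B by (simp add: binary_moment_def)
qed

lemma moment_Gbar:
  assumes B: "B \<in> binary_matrices m k" and p: "even p" "p > 0"
  shows "moment (Suc m) (set (cols (Gbar B))) p = 2 ^ p / 2 * (4 ^ Suc m / 2 ^ m) * binary_moment B p"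
proof -
  have Bc: "B \<in> carrier_mat m k" using B by (simp add: binary_matrices_def)
  let ?G = "Gbar B" and ?S = "set (cols (Gbar B))"
  have d: "dim_row ?G = Suc m" "dim_col ?G = Suc k" using Gbar_dim[OF Bc] by auto
  have S: "?S = col ?G ` {..<Suc k}" using d by (simp add: cols_def atLeast0LessThan del: upt_Suc)
  have inj: "inj_on (col ?G) {..<Suc k}"
    using card_Gbar[OF B] unfolding S by (intro eq_card_imp_inj_on) simp_all
  have entry: "col ?G j $ i = (if i = 0 then 1 else if j = 0 then 0 else 2 * of_nat (B $$ (i - 1, j - 1)))"
    if "i < Suc m" "j < Suc k" for i j using that d Gbar_entry[OF Bc that] by simp
  have "bij_betw (\<lambda>j. col ?G (Suc j)) {..<k} (?S - {col ?G 0})"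
  proof (rule bij_betw_imageI)
    show "inj_on (\<lambda>j. col ?G (Suc j)) {..<k}" using inj by (auto simp: inj_on_def)
    show "(\<lambda>j. col ?G (Suc j)) ` {..<k} = ?S - {col ?G 0}"
    proof -
      have "{..<Suc k} - {0} = Suc ` {..<k}" by (auto simp: lessThan_Suc_eq_insert_0)
      then have "(\<lambda>j. col ?G (Suc j)) ` {..<k} = col ?G ` ({..<Suc k} - {0})"
        by (simp add: image_image)
      also have "\<dots> = ?S - {col ?G 0}"
        unfolding S using inj_on_image_set_diff[OF inj, of "{..<Suc k}" "{0}"] by simp
      finally show ?thesis .
    qed
  qed
  moreover have "g $ 0 = 1" if "g \<in> ?S" for g using that entry unfolding S by auto
  moreover have "col ?G 0 \<in> ?S" unfolding S by auto
  ultimately show ?thesis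
    using Bc p by (intro moment_eq_binary_moment[OF even_set_Gbar[OF Bc], where i = 0]) (auto simp: entry skip_def)
qed

text \<open>This replaces the reduction to the displayed form by row operations. Differences from
  \<open>g0\<close> have entries 0 and 2, which \<open>B\<close> records as 0 and 1. Elements of
  \<open>S\<close> agree at \<open>i\<close>, so distinct ones differ elsewhere; hence the columns
  are distinct and nonnull.\<close>

lemma even_set_binary_matrix:
  assumes E: "even_set (Suc m) S" and card: "card S = Suc k"
  shows "\<exists>B\<in>binary_matrices m k. \<forall>p. even p \<and> p > 0 \<longrightarrow>
    moment (Suc m) S p = 2 ^ p / 2 * (4 ^ Suc m / 2 ^ m) * binary_moment B p"
proof -
  have "S \<noteq> {}" using card by auto
  then obtain g0 where g0: "g0 \<in> S" by auto
  obtain i where i: "i < Suc m" "\<And>g. g \<in> S \<Longrightarrow> g $ i = 1"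
    using even_set_common_one[OF E \<open>S \<noteq> {}\<close>] by blast
  have fin: "finite S" using E finite_Omega finite_subset unfolding even_set_def by blast
  have "card (S - {g0}) = k" using card g0 fin by simp
  then obtain f where f: "bij_betw f {..<k} (S - {g0})"
    using ex_bij_betw_nat_finite[of "S - {g0}"] fin by (auto simp: atLeast0LessThan)
  define B where "B = mat m k (\<lambda>(l, j). if f j $ skip i l = g0 $ skip i l then 0 else 1 :: nat)"
  have Bc: "B \<in> carrier_mat m k" by (simp add: B_def)
  have fS: "f j \<in> S" "f j \<noteq> g0" if "j < k" for j using f that by (auto simp: bij_betw_def)
  have Bf: "f j $ skip i l - g0 $ skip i l = 2 * of_nat (B $$ (l, j))" if lj: "l < m" "j < k" for l j
  proof -
    note d = even_set_diff[OF E fS(1)[OF lj(2)] g0]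
    have "even_Z4 ((f j - g0) $ skip i l)" using even_vecs_index[OF d(1) skip_less[OF lj(1)]] .
    then have "even_Z4 (f j $ skip i l - g0 $ skip i l)" using d skip_less[OF lj(1), of i] by simp
    then show ?thesis using lj by (auto simp: B_def even_Z4_def)
  qed
  have ext: "g = h" if gh: "g \<in> S" "h \<in> S" and eq: "\<And>l. l < m \<Longrightarrow> g $ skip i l = h $ skip i l" for g h
  proof (rule eq_vecI)
    have c: "g \<in> carrier_vec (Suc m)" "h \<in> carrier_vec (Suc m)" using even_set_diff[OF E gh] by auto
    show "dim_vec g = dim_vec h" using c by simp
    fix a assume "a < dim_vec h"
    then have "a \<in> insert i (skip i ` {..<m})" using c insert_skip_image[OF i(1)] by auto
    then show "g $ a = h $ a" using eq i(2) gh by auto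
  qed
  have colB: "col B j $ l = (if f j $ skip i l = g0 $ skip i l then 0 else 1)" if "l < m" "j < k" for l j
    using that by (simp add: B_def)
  have "distinct (cols B)"
    unfolding distinct_conv_nth
  proof (intro allI impI)
    fix j j' assume jj: "j < length (cols B)" "j' < length (cols B)" "j \<noteq> j'"
    then have k: "j < k" "j' < k" using Bc by auto
    have "f j = f j'" if eq: "col B j = col B j'"
    proof (rule ext)
      fix l assume l: "l < m"
      have "B $$ (l, j) = B $$ (l, j')" using arg_cong[OF eq, of "\<lambda>v. v $ l"] l k Bc by simp
      then show "f j $ skip i l = f j' $ skip i l"
        using Bf[OF l k(1)] Bf[OF l k(2)] by (metis diff_add_cancel)
    qed (use fS k in auto)
    then show "cols B ! j \<noteq> cols B ! j'"
      using f k jj(3) Bc by (auto simp: bij_betw_def inj_on_def)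
  qed
  moreover have "0\<^sub>v m \<notin> set (cols B)"
  proof
    assume "0\<^sub>v m \<in> set (cols B)"
    then obtain j where j: "j < k" "col B j = 0\<^sub>v m" using Bc by (auto simp: cols_def)
    have "f j = g0"
    proof (rule ext)
      fix l assume l: "l < m"
      have "col B j $ l = 0" using j l by simp
      then show "f j $ skip i l = g0 $ skip i l" using colB[OF l j(1)] by (auto split: if_splits)
    qed (use fS j g0 in auto)
    then show False using fS j by auto
  qed
  moreover have "elements_mat B \<subseteq> {0, 1}" by (auto simp: elements_mat_def B_def)
  ultimately have "B \<in> binary_matrices m k" using Bc by (simp add: binary_matrices_def)
  then show ?thesis
    using moment_eq_binary_moment[OF E g0 i Bc f Bf] by blast
qed

section \<open>Comparison of the two minimization problems\<close>

text \<open>Each wordlength is a positive multiple of the moment of the same order plus a fixed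
  combination of lower moments, and the moments of order 0, 1 and 2 are the same for all
  candidates.\<close>

lemma MA_QC_design_iff_moments:
  assumes S: "S \<subseteq> Omega n" and s: "s + card S = card (Omega n)"
  shows "MA_QC_design n s (yielded_design n S) \<longleftrightarrow>
    sequentially_minimizes {T. T \<subseteq> Omega n \<and> card T = card S} (\<lambda>T. moment n (Omega n - T)) {3..} S"
    (is "_ \<longleftrightarrow> sequentially_minimizes ?X ?M _ S")
proof -
  have SX: "S \<in> ?X" using S by simp
  have card: "card (Omega n - T) = s" if "T \<in> ?X" for T
    using that s by (auto simp: card_Diff_subset finite_subset)
  have "{U. U \<subseteq> Omega n \<and> card U = s} = (\<lambda>T. Omega n - T) ` ?X"
  proof (intro equalityI subsetI)
    fix U assume U: "U \<in> {U. U \<subseteq> Omega n \<and> card U = s}"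
    then have "card (Omega n - U) = card S" using s by (auto simp: card_Diff_subset finite_subset)
    then show "U \<in> (\<lambda>T. Omega n - T) ` ?X" using U by (intro image_eqI[of _ _ "Omega n - U"]) auto
  qed (use card in auto)
  then have QC: "QC_designs n s = yielded_design n ` ?X"
    by (simp add: QC_designs_def yielded_design_def[abs_def] image_image)
  let ?w = "\<lambda>T. wordlength (yielded_design n T)"
  have w: "?w T k = (\<Sum>u\<in>carrier_vec n. poly (kraw (2 * s) k) (colsum (Omega n - T) u)) / 4 ^ n"
    if "T \<in> ?X" for T k
    using wordlength_QC[of "Omega n - T" n k] card[OF that] by (simp add: yielded_design_def)
  \<comment> \<open>Wordlengths of order above \<open>2 * s\<close> vanish, so the index set may be
    extended to all orders from 3 on.\<close>
  have w0: "?w T k = 0" if "T \<in> ?X" "k > 2 * s" for T k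
    unfolding yielded_design_def using card[OF that(1)] that(2)
    by (intro wordlength_eq_0) (auto simp: QC_design_def card_cartesian_product)
  have "MA_QC_design n s (yielded_design n S) \<longleftrightarrow> sequentially_minimizes ?X ?w {3..2 * s} S"
    unfolding MA_QC_design_def QC by (rule sequentially_minimizes_image[OF SX])
  also have "\<dots> \<longleftrightarrow> sequentially_minimizes ?X ?w {3..} S"
    by (rule sequentially_minimizes_index_mono[symmetric]) (auto simp: w0)
  also have "\<dots> \<longleftrightarrow> sequentially_minimizes ?X ?M {3..} S"
  proof (rule sequentially_minimizes_cong_order[symmetric])
    fix k T U assume k: "k \<in> {3..}" and T: "T \<in> ?X" and U: "U \<in> ?X"
      and agree: "\<And>j. \<lbrakk>j \<in> {3..}; j < k\<rbrakk> \<Longrightarrow> ?M T j = ?M U j"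
    have low: "?M T j = ?M U j" if "j < 3" for j
    proof -
      from that consider "j = 0" | "j = 1" | "j = 2" by linarith
      then show ?thesis
      proof cases
        case 1 then show ?thesis by (simp add: moment_def)
      next
        case 2 then show ?thesis by (simp add: moment_def sum_colsum_carrier)
      next
        case 3 then show ?thesis using card[OF T] card[OF U] by (simp add: moment_2)
      qed
    qed
    have eq: "?M T j = ?M U j" if "j < k" for j
      using low[of j] agree[of j] that by (cases "j < 3") auto
    let ?p = "kraw (2 * s) k"
    have W: "?w V k = (coeff ?p k * ?M V k + (\<Sum>j<k. coeff ?p j * ?M V j)) / 4 ^ n" if "V \<in> ?X" for V
      unfolding w[OF that] moment_def by (simp add: sum_poly_moments[OF degree_kraw])
    have "(\<Sum>j<k. coeff ?p j * ?M T j) = (\<Sum>j<k. coeff ?p j * ?M U j)"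
      by (intro sum.cong refl) (simp add: eq)
    then show "?M T k \<le> ?M U k \<longleftrightarrow> ?w T k \<le> ?w U k"
      using W[OF T] W[OF U] coeff_kraw_pos[of "2 * s" k] by (simp add: divide_le_cancel)
  qed
  finally show ?thesis .
qed

text \<open>The third moment singles out the even sets. Among these the odd moments of the
  complement are constant, and its even moments differ from those of the set by a constant.\<close>

lemma sequentially_minimizes_moment_even_set:
  assumes S: "even_set n S" and pos: "card S > 0"
  shows "sequentially_minimizes {T. T \<subseteq> Omega n \<and> card T = card S} (\<lambda>T. moment n (Omega n - T)) {3..} S
    \<longleftrightarrow> sequentially_minimizes {T. even_set n T \<and> card T = card S} (\<lambda>T p. moment n T (2 * p)) {2..} S"
    (is "sequentially_minimizes ?X ?M _ S \<longleftrightarrow> sequentially_minimizes ?Z _ _ S")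
proof -
  have "{3 :: nat..} = insert 3 {4..}" by auto
  then have "sequentially_minimizes ?X ?M {3..} S \<longleftrightarrow> sequentially_minimizes ?X ?M (insert 3 {4..}) S"
    by simp
  also have "\<dots> \<longleftrightarrow> sequentially_minimizes ?Z ?M {4..} S"
  proof (rule sequentially_minimizes_first)
    show "?Z \<subseteq> ?X" by (auto simp: even_set_def)
    show "?M T 3 \<le> ?M U 3" if "U \<in> ?X" "T \<in> ?Z" for T U
      using moment_3_complement_min(1)[of n T U] that pos by simp
    show "U \<in> ?Z" if "U \<in> ?X" "T \<in> ?Z" "?M U 3 = ?M T 3" for T U
      using moment_3_complement_min(2)[of n T U] that pos by simp
  qed (use S in auto)
  also have "\<dots> \<longleftrightarrow> sequentially_minimizes ?Z (\<lambda>T p. ?M T (2 * p)) {2..} S"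
  proof -
    have odd: "?M T k = ?M U k" if "odd k" "T \<in> ?Z" "U \<in> ?Z" for k T U
    proof -
      have "T \<noteq> {}" "U \<noteq> {}" using that pos by auto
      then have "moment n T k = 0" "moment n U k = 0"
        using moment_even_set[of n T _ k] moment_even_set[of n U _ k] that odd_pos[of k] by auto
      then show ?thesis using moment_complement_even_set[of n T U k] that pos by simp
    qed
    have "sequentially_minimizes ?Z ?M {2 * 2..} S \<longleftrightarrow> sequentially_minimizes ?Z (\<lambda>T p. ?M T (2 * p)) {2..} S"
      by (rule sequentially_minimizes_even_indices) (rule odd)
    moreover have "{2 * 2 :: nat..} = {4..}" by simp
    ultimately show ?thesis by (simp only:)
  qed
  also have "\<dots> \<longleftrightarrow> sequentially_minimizes ?Z (\<lambda>T p. moment n T (2 * p)) {2..} S"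
  proof (rule sequentially_minimizes_cong_order)
    fix p T U assume "T \<in> ?Z" "U \<in> ?Z"
    then show "?M T (2 * p) \<le> ?M U (2 * p) \<longleftrightarrow> moment n T (2 * p) \<le> moment n U (2 * p)"
      using moment_complement_even_set[of n T U "2 * p"] pos by (simp, linarith)
  qed
  finally show ?thesis .
qed

lemma sequentially_minimizes_regular_iff_moments:
  assumes B: "B \<in> binary_matrices m k"
  shows "sequentially_minimizes (regular_design ` binary_matrices m k)
      (\<lambda>d r. wordlength d (2 * r - 1) + wordlength d (2 * r)) {2..} (regular_design B)
    \<longleftrightarrow> sequentially_minimizes (binary_matrices m k) (\<lambda>C p. binary_moment C (2 * p)) {2..} B"
proof -
  let ?Y = "binary_matrices m k"
  let ?w = "\<lambda>C r. wordlength (regular_design C) (2 * r - 1) + wordlength (regular_design C) (2 * r)"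
  have "sequentially_minimizes ?Y (\<lambda>C p. binary_moment C (2 * p)) {2..} B \<longleftrightarrow> sequentially_minimizes ?Y ?w {2..} B"
  proof (rule sequentially_minimizes_cong_order)
    fix r C D assume r: "r \<in> {2..}" and C: "C \<in> ?Y" and D: "D \<in> ?Y"
      and agree: "\<And>j. \<lbrakk>j \<in> {2..}; j < r\<rbrakk> \<Longrightarrow> binary_moment C (2 * j) = binary_moment D (2 * j)"
    have c: "C \<in> carrier_mat m k" "D \<in> carrier_mat m k" using C D by (auto simp: binary_matrices_def)
    \<comment> \<open>The comparison starts at the fourth moment. That the second one is constant is
      read off from the even set of \<open>Gbar F\<close>, whose second moment depends only on its
      size.\<close>
    have "moment (Suc m) (set (cols (Gbar F))) 2 = 2 * 4 ^ Suc m * Suc k" if "F \<in> ?Y" for F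
    proof -
      have "F \<in> carrier_mat m k" using that by (simp add: binary_matrices_def)
      then show ?thesis
        using moment_2[of "set (cols (Gbar F))" "Suc m"] even_set_Gbar[of F m k] card_Gbar[OF that]
        by (simp add: even_set_def)
    qed
    from this[OF C] this[OF D]
    have "2\<^sup>2 / 2 * (4 ^ Suc m / 2 ^ m) * binary_moment C 2 = 2\<^sup>2 / 2 * (4 ^ Suc m / 2 ^ m) * binary_moment D 2"
      using moment_Gbar[OF C, of 2] moment_Gbar[OF D, of 2] by (metis even_numeral zero_less_numeral)
    then have two: "binary_moment C 2 = binary_moment D 2" by simp
    have eq: "binary_moment C (2 * q) = binary_moment D (2 * q)" if "q < r" for q
    proof -
      consider "q = 0" | "q = 1" | "q \<ge> 2" by linarith
      then show ?thesis
      proof cases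
        case 1 then show ?thesis using c by (simp add: binary_moment_def)
      next
        case 2 then show ?thesis using two by simp
      next
        case 3 then show ?thesis using agree that by simp
      qed
    qed
    let ?p = "kraw (real k + 1) (2 * r)"
    have W: "?w F r = (coeff ?p (2 * r) * binary_moment F (2 * r) + (\<Sum>j<2 * r. coeff ?p j * binary_moment F j)) / 2 ^ m"
      if "F \<in> carrier_mat m k" for F
      using that wordlength_regular_pair[OF that, of r] r
      by (simp add: sum_poly_moments[OF degree_kraw] binary_moment_def)
    have "(\<Sum>j<2 * r. coeff ?p j * binary_moment C j) = (\<Sum>j<2 * r. coeff ?p j * binary_moment D j)"
    \<comment> \<open>Odd \<open>j\<close> have coefficient zero by the parity of Krawtchouk
      polynomials, so only even moments have to agree.\<close>
    proof (intro sum.cong refl)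
      fix j assume "j \<in> {..<2 * r}"
      then show "coeff ?p j * binary_moment C j = coeff ?p j * binary_moment D j"
        using eq[of "j div 2"] coeff_kraw_odd[of "2 * r" j] by (cases "even j") auto
    qed
    then show "binary_moment C (2 * r) \<le> binary_moment D (2 * r) \<longleftrightarrow> ?w C r \<le> ?w D r"
      using W[OF c(1)] W[OF c(2)] coeff_kraw_pos[of "real k + 1" "2 * r"] by (simp add: divide_le_cancel)
  qed
  then show ?thesis using sequentially_minimizes_image[OF B, of regular_design] by simp
qed

lemma sequentially_minimizes_even_set_iff_binary:
  assumes B: "B \<in> binary_matrices m k"
  shows "sequentially_minimizes {T. even_set (Suc m) T \<and> card T = Suc k} (\<lambda>T p. moment (Suc m) T (2 * p)) {2..}
      (set (cols (Gbar B)))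
    \<longleftrightarrow> sequentially_minimizes (binary_matrices m k) (\<lambda>C p. binary_moment C (2 * p)) {2..} B"
proof (rule sequentially_minimizes_transfer[where c = "\<lambda>p. 2 ^ (2 * p) / 2 * (4 ^ Suc m / 2 ^ m)"])
  have G: "set (cols (Gbar C)) \<in> {T. even_set (Suc m) T \<and> card T = Suc k}" if "C \<in> binary_matrices m k" for C
    using that even_set_Gbar[of C m k] card_Gbar[OF that] by (simp add: binary_matrices_def)
  show "set (cols (Gbar B)) \<in> {T. even_set (Suc m) T \<and> card T = Suc k}" using G[OF B] .
  show "moment (Suc m) (set (cols (Gbar B))) (2 * p) = 2 ^ (2 * p) / 2 * (4 ^ Suc m / 2 ^ m) * binary_moment B (2 * p)"
    if "p \<in> {2..}" for p
    using that by (intro moment_Gbar[OF B]) auto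
  show "\<exists>C\<in>binary_matrices m k. \<forall>p\<in>{2..}.
      moment (Suc m) T (2 * p) = 2 ^ (2 * p) / 2 * (4 ^ Suc m / 2 ^ m) * binary_moment C (2 * p)"
    if T: "T \<in> {T. even_set (Suc m) T \<and> card T = Suc k}" for T
  proof -
    obtain C where "C \<in> binary_matrices m k" "\<forall>p. even p \<and> p > 0 \<longrightarrow>
        moment (Suc m) T p = 2 ^ p / 2 * (4 ^ Suc m / 2 ^ m) * binary_moment C p"
      using even_set_binary_matrix[of m T k] T by blast
    then show ?thesis by (intro bexI[of _ C]) auto
  qed
  show "\<exists>T\<in>{T. even_set (Suc m) T \<and> card T = Suc k}. \<forall>p\<in>{2..}.
      moment (Suc m) T (2 * p) = 2 ^ (2 * p) / 2 * (4 ^ Suc m / 2 ^ m) * binary_moment C (2 * p)"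
    if C: "C \<in> binary_matrices m k" for C
    using G[OF C] moment_Gbar[OF C] by (intro bexI[of _ "set (cols (Gbar C))"]) auto
qed (use B in auto)

theorem theorem2:
  fixes n v s :: nat and B :: "nat mat" and Sbar :: "4 vec set"
  assumes "n \<ge> 2"
    and "v = (4 ^ n - 2 ^ n) div 2"
    and "2 \<le> v - s" and "v - s \<le> 2 ^ (n - 1)"
    and "B \<in> binary_matrices (n - 1) (v - s - 1)"
    and "even_set n Sbar"
    and "Sbar = set (cols (Gbar B))"
  shows "MA_QC_design n s (yielded_design n Sbar) \<longleftrightarrow>
    sequentially_minimizes (regular_design ` binary_matrices (n - 1) (v - s - 1))
      (\<lambda>d r. wordlength d (2 * r - 1) + wordlength d (2 * r)) {2..} (regular_design B)"
proof -
  obtain m where m: "n = Suc m" using assms(1) by (cases n) auto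
  define k where "k = v - s - 1"
  have B: "B \<in> binary_matrices m k" using assms(5) by (simp add: m k_def)
  have card: "card Sbar = Suc k" using card_Gbar[OF B] assms(7) by simp
  \<comment> \<open>The equation \<open>2 * card (Omega n) = 4 ^ n - 2 ^ n\<close> shows that the
    division by 2 in \<open>v\<close> is exact.\<close>
  have "real (2 * card (Omega n)) = real (4 ^ n - 2 ^ n)"
    unfolding card_Omega by (simp add: of_nat_diff power_mono)
  then have "2 * card (Omega n) = 4 ^ n - 2 ^ n" by (simp only: of_nat_eq_iff)
  then have "card (Omega n) = v" using assms(2) by simp
  \<comment> \<open>Since \<open>2 \<le> v - s\<close>, the subtractions in \<open>k\<close> are not
    truncated and \<open>v = s + k + 1\<close>.\<close>
  then have "s + card Sbar = card (Omega n)" using card assms(3) by (simp add: k_def)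
  moreover have "Sbar \<subseteq> Omega n" using assms(6) by (simp add: even_set_def)
  ultimately have "MA_QC_design n s (yielded_design n Sbar) \<longleftrightarrow>
      sequentially_minimizes {T. even_set n T \<and> card T = card Sbar} (\<lambda>T p. moment n T (2 * p)) {2..} Sbar"
    using MA_QC_design_iff_moments sequentially_minimizes_moment_even_set[OF assms(6)] card by simp
  also have "\<dots> \<longleftrightarrow> sequentially_minimizes (binary_matrices m k) (\<lambda>C p. binary_moment C (2 * p)) {2..} B"
    using sequentially_minimizes_even_set_iff_binary[OF B] card assms(7) m by simp
  finally show ?thesis
    using sequentially_minimizes_regular_iff_moments[OF B] m k_def by simp
qed

end
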